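(* Let $J$ be a $\times d$-invariant set satisfying (i) $d$ is prime and (ii) $0,d-1\in E$ and $E$ contains no two integers differing by $1$; let $\delta$ be its Hausdorff dimension and $\mu=\mathcal{H}^\delta|_J/\mathcal{H}^\delta(J)$. Let $x\in J$ be $\mu$-generic (i.e. the statement holds for $\mu$-almost every $x\in J$). Fix any $\psi:\mathbb{N}\to(0,\infty)$ and let $f$ be a dimension function such that $t\mapsto t^{-\delta}f(t)$ is monotonic. Let $\mathrm{WA}_{\psi,\mathrm{int}}$ denote the set of points $y\in J_x$ that are intrinsically well approximable (relative to $J_x$) with respect to $\psi$. Then \[ \mathcal{H}^f(\mathrm{WA}_{\psi,\mathrm{int}})=\begin{cases}0&\text{if }\sum_{n=1}^\infty f\big(\psi(d^n)/d^n\big)\,(d^n)^\delta<\infty,\\ \mathcal{H}^f(J)&\text{if }\sum_{n=1}^\infty f\big(\psi(d^n)/d^n\big)\,(d^n)^\delta=\infty,\end{cases} \] where $\mathcal{H}^f$ denotes Hausdorff $f$-measure.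
   Context: Fix an integer $d\ge2$ and $E\subseteq\{0,\dots,d-1\}$ with $1<\#E<d$. The $\times d$-invariant set is $J=\{x\in[0,1]: x=\sum_{i\ge1}a_id^{-i}\text{ with all }a_i\in E\}$. For $x\in\mathbb{R}$, $J_x=\{t-x:t\in J\}$. A dimension function is a nondecreasing continuous $f:(0,\infty)\to(0,\infty)$ with $f(t)\to0$ as $t\to0$. For $S\subseteq\mathbb{R}$, $\psi:\mathbb{N}\to(0,\infty)$: $y\in S$ is intrinsically approximable w.r.t. $\psi$ if there are infinitely many $p/q\in\mathbb{Q}\cap S$ (lowest terms) with $|y-p/q|\le\psi(q)/q$; badly intrinsically approximable if for some $\varepsilon>0$ it is not intrinsically approximable w.r.t. $\varepsilon\psi$; intrinsically well approximable otherwise. *)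

theory Defs
  imports "HOL-Analysis.Analysis"
begin

definition digit_set :: "nat \<Rightarrow> nat set \<Rightarrow> real set" where
  "digit_set d E = {x \<in> {0..1}. \<exists>a :: nat \<Rightarrow> nat. (\<forall>i. a i \<in> E) \<and>
       x = (\<Sum>i. real (a i) / real d ^ Suc i)}"

definition translate_set :: "real set \<Rightarrow> real \<Rightarrow> real set" where
  "translate_set J x = (\<lambda>t. t - x) ` J"

definition dimension_function :: "(real \<Rightarrow> real) \<Rightarrow> bool" where
  "dimension_function f \<longleftrightarrow> mono_on {0<..} f \<and> continuous_on {0<..} f \<and>
     (\<forall>t>0. f t > 0) \<and> (f \<longlongrightarrow> 0) (at_right 0)"

text \<open>Gauge value of a set of diameter t; a set of diameter 0 costs 0
  (continuous extension of f to 0).\<close>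
definition gauge_val :: "(real \<Rightarrow> real) \<Rightarrow> real \<Rightarrow> ennreal" where
  "gauge_val f t = (if t = 0 then 0 else ennreal (f t))"

definition hausdorff_content :: "(real \<Rightarrow> real) \<Rightarrow> real \<Rightarrow> real set \<Rightarrow> ennreal" where
  "hausdorff_content f r A =
     (INF U \<in> {U :: nat \<Rightarrow> real set. A \<subseteq> (\<Union>i. U i) \<and> (\<forall>i. bounded (U i) \<and> diameter (U i) \<le> r)}.
        \<Sum>i. gauge_val f (diameter (U i)))"

definition hausdorff_measure :: "(real \<Rightarrow> real) \<Rightarrow> real set \<Rightarrow> ennreal" where
  "hausdorff_measure f A = (SUP r \<in> {0<..}. hausdorff_content f r A)"

definition hausdorff_dim :: "real set \<Rightarrow> real" where
  "hausdorff_dim A = Inf {s. 0 < s \<and> hausdorff_measure (\<lambda>t. t powr s) A = 0}"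

definition hausdorff_meas :: "(real \<Rightarrow> real) \<Rightarrow> real measure" where
  "hausdorff_meas f = measure_of UNIV (sets borel) (hausdorff_measure f)"

definition normalized_hausdorff :: "real \<Rightarrow> real set \<Rightarrow> real measure" where
  "normalized_hausdorff s J =
     scale_measure (inverse (hausdorff_measure (\<lambda>t. t powr s) J))
       (density (hausdorff_meas (\<lambda>t. t powr s)) (indicator J))"

definition intr_approx :: "real set \<Rightarrow> (nat \<Rightarrow> real) \<Rightarrow> real \<Rightarrow> bool" where
  "intr_approx S \<psi> y \<longleftrightarrow>
     infinite {(p :: int, q :: nat). 0 < q \<and> coprime p (int q) \<and> real_of_int p / real q \<in> S \<and>
        \<bar>y - real_of_int p / real q\<bar> \<le> \<psi> q / real q}"

definition badly_intr_approx :: "real set \<Rightarrow> (nat \<Rightarrow> real) \<Rightarrow> real \<Rightarrow> bool" where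
  "badly_intr_approx S \<psi> y \<longleftrightarrow> (\<exists>\<epsilon>>0. \<not> intr_approx S (\<lambda>q. \<epsilon> * \<psi> q) y)"

definition WA_int :: "real set \<Rightarrow> (nat \<Rightarrow> real) \<Rightarrow> real set" where
  "WA_int S \<psi> = {y \<in> S. \<not> badly_intr_approx S \<psi> y}"

end

theory Submission
  imports Defs "HOL-Library.Sublist"
begin

text \<open>
  Write \<open>N = card E\<close> and \<open>\<delta> = ln N / ln d\<close>. If the digits of \<open>x\<close> are generic, every rational in \<open>J - x\<close>
  has a power of \<open>d\<close> as denominator, and those with denominator \<open>d^n\<close> are the differences \<open>t - x\<close> where
  \<open>t\<close> has arbitrary digits in \<open>E\<close> up to place \<open>n\<close> and the digits of \<open>x\<close> afterwards. So a point of \<open>J\<close> is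
  well approximable when its digits match those of \<open>x\<close> on long enough runs starting at infinitely
  many places \<open>n\<close>. Convergence is the usual covering argument. For divergence there are two cases. If
  \<open>f(t) = O(t^\<delta>)\<close>, the matching events with a mismatch demanded just before the run are pairwise
  disjoint or independent, so by Chebyshev's inequality almost every point matches infinitely often.
  Otherwise \<open>\<phi>(k) = N^k f(d^-k)\<close> increases to infinity, and any cover of the well approximable set
  of total cost less than a constant times \<open>\<phi>(L)\<close> is escaped by a branch of the digit tree: words
  \<open>w\<close> below which the cover costs less than \<open>f(d^-|w|)\<close> can be extended to longer such words that avoid
  the cover and end in a prescribed match.
\<close>

text \<open>A well approximable point must beat \<open>\<epsilon> * \<psi>\<close> for every
  \<epsilon>, while the series sees only \<psi>. The upper bound uses the single value 1/2, which
  gives the covering intervals diameter exactly \<open>\<psi> (d^n) / d^n\<close>. The lower bounds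
  use a family of run lengths, the j-th for the tolerance \<open>\<psi> / (j+1)\<close>; the
  constants this creates are absorbed by \<open>f t \<le> C * t^\<delta>\<close> in one case and by
  \<open>f (T * t) \<le> T^\<delta> * f t\<close> for \<open>T \<ge> 1\<close> in the other. The
  obstacle in the unbounded case is that a prescribed match is a long forced run, along which a
  cover may be concentrated. So the places of the matches are chosen after the cover is known, and
  no measure on the limsup set is built in advance. Passing from covering sets to words costs a
  factor \<open>2 * d + 3\<close>, a bound for the number of words of length k seen by a set of
  diameter at most \<open>d / d^k\<close>. Digits are numbered from 0, so a run that starts after
  place n belongs to the denominator \<open>d^(n+1)\<close>; hence the many
  \<open>Suc n\<close>.\<close>

section \<open>Hausdorff contents and measures: subadditivity, null sets, translations\<close>

lemma hausdorff_content_le_suminf: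
  assumes "A \<subseteq> (\<Union>i. U i)" "\<And>i. bounded (U i)" "\<And>i. diameter (U i) \<le> r"
  shows "hausdorff_content f r A \<le> (\<Sum>i. gauge_val f (diameter (U i)))"
  unfolding hausdorff_content_def by (rule INF_lower) (use assms in auto)

lemma hausdorff_content_le:
  assumes "A \<subseteq> U" "bounded U" "diameter U \<le> r" "0 \<le> r"
  shows "hausdorff_content f r A \<le> gauge_val f (diameter U)"
proof -
  let ?U = "\<lambda>i::nat. if i = 0 then U else {}"
  have "hausdorff_content f r A \<le> (\<Sum>i. gauge_val f (diameter (?U i)))"
    by (rule hausdorff_content_le_suminf) (use assms in \<open>auto split: if_splits\<close>)
  also have "\<dots> = (\<Sum>i\<in>{0}. gauge_val f (diameter (?U i)))"
    by (rule suminf_finite) (auto simp: gauge_val_def)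
  finally show ?thesis by simp
qed

lemma hausdorff_content_mono: "A \<subseteq> B \<Longrightarrow> hausdorff_content f r A \<le> hausdorff_content f r B"
  unfolding hausdorff_content_def by (rule INF_superset_mono) auto

lemma hausdorff_content_empty: "0 \<le> r \<Longrightarrow> hausdorff_content f r {} = 0"
  using hausdorff_content_le[of "{}" "{}" r f] by (simp add: gauge_val_def)

definition near_cover :: "(real \<Rightarrow> real) \<Rightarrow> real \<Rightarrow> real set \<Rightarrow> ennreal \<Rightarrow> (nat \<Rightarrow> real set) \<Rightarrow> bool" where
  "near_cover f r A c U \<longleftrightarrow> A \<subseteq> (\<Union>i. U i) \<and> (\<forall>i. bounded (U i) \<and> diameter (U i) \<le> r) \<and>
     (\<Sum>i. gauge_val f (diameter (U i))) < c"

lemma ex_near_cover: "hausdorff_content f r A < c \<Longrightarrow> \<exists>U. near_cover f r A c U"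
  unfolding hausdorff_content_def near_cover_def INF_less_iff by auto

lemma near_coverD:
  assumes "near_cover f r A c U"
  shows "A \<subseteq> (\<Union>i. U i)" "bounded (U i)" "diameter (U i) \<le> r"
    "(\<Sum>i. gauge_val f (diameter (U i))) < c"
  using assms unfolding near_cover_def by auto

lemma hausdorff_content_UN:
  fixes A :: "nat \<Rightarrow> real set"
  shows "hausdorff_content f r (\<Union>i. A i) \<le> (\<Sum>i. hausdorff_content f r (A i))"
proof (rule ennreal_le_epsilon)
  fix e :: real assume fin: "(\<Sum>i. hausdorff_content f r (A i)) < top" and e: "0 < e"
  define h where "h i = e * (1/2) ^ Suc i" for i
  have h: "0 < h i" for i unfolding h_def using e by simp
  have lt: "hausdorff_content f r (A i) < hausdorff_content f r (A i) + ennreal (h i)" for i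
  proof -
    obtain c where c: "hausdorff_content f r (A i) = ennreal c" "0 \<le> c"
      using ennreal_suminf_lessD[OF fin, of i] by (metis less_top_ennreal)
    have "ennreal c < ennreal (c + h i)" using c(2) h[of i] by (simp add: ennreal_less_iff)
    then show ?thesis unfolding c(1) using c(2) h[of i] by (simp add: less_imp_le)
  qed
  have "\<forall>i. \<exists>U. near_cover f r (A i) (hausdorff_content f r (A i) + ennreal (h i)) U"
    by (intro allI ex_near_cover lt)
  from choice[OF this] obtain U where
    "\<forall>i. near_cover f r (A i) (hausdorff_content f r (A i) + ennreal (h i)) (U i)" ..
  then have nc: "near_cover f r (A i) (hausdorff_content f r (A i) + ennreal (h i)) (U i)" for i ..
  note U = near_coverD[OF nc]
  let ?V = "\<lambda>k. case prod_decode k of (i, j) \<Rightarrow> U i j"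
  have "hausdorff_content f r (\<Union>i. A i) \<le> (\<Sum>k. gauge_val f (diameter (?V k)))"
  proof (rule hausdorff_content_le_suminf)
    show "(\<Union>i. A i) \<subseteq> (\<Union>k. ?V k)"
    proof
      fix x assume "x \<in> (\<Union>i. A i)"
      then obtain i where "x \<in> A i" by (rule UN_E)
      then obtain j where "x \<in> U i j" using U(1)[of i] by (meson UN_E subsetD)
      then have "x \<in> ?V (prod_encode (i, j))" by simp
      then show "x \<in> (\<Union>k. ?V k)" by (rule UN_I[OF UNIV_I])
    qed
  qed (simp_all add: U(2,3) case_prod_beta)
  also have "\<dots> = (\<Sum>k. (gauge_val f \<circ> diameter \<circ> case_prod U) (prod_decode k))"
    by (simp add: case_prod_beta)
  also have "\<dots> = (\<Sum>i. \<Sum>j. gauge_val f (diameter (U i j)))"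
    using suminf_ennreal_2dimen[of "\<lambda>i. \<Sum>j. gauge_val f (diameter (U i j))" "gauge_val f \<circ> diameter \<circ> case_prod U"]
    by (simp add: comp_def)
  also have "\<dots> \<le> (\<Sum>i. hausdorff_content f r (A i) + ennreal (h i))"
    by (rule suminf_le) (use U(4) in \<open>simp_all add: less_imp_le\<close>)
  also have "\<dots> = (\<Sum>i. hausdorff_content f r (A i)) + (\<Sum>i. ennreal (h i))"
    by (rule suminf_add[symmetric]) auto
  also have "(\<Sum>i. ennreal (h i)) = ennreal e"
  proof -
    have hs: "h sums e" unfolding h_def using sums_mult[OF power_half_series, of e] by simp
    show ?thesis
      by (subst suminf_ennreal2) (use h hs in \<open>auto simp: sums_iff less_imp_le\<close>)
  qed
  finally show "hausdorff_content f r (\<Union>i. A i) \<le> (\<Sum>i. hausdorff_content f r (A i)) + ennreal e" .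
qed

lemma hausdorff_content_Un:
  assumes "0 \<le> r"
  shows "hausdorff_content f r (A \<union> B) \<le> hausdorff_content f r A + hausdorff_content f r B"
proof -
  let ?A = "\<lambda>i::nat. if i = 0 then A else if i = 1 then B else {}"
  have "A \<union> B \<subseteq> (\<Union>i. ?A i)"
  proof -
    have "?A 0 \<subseteq> (\<Union>i. ?A i)" "?A 1 \<subseteq> (\<Union>i. ?A i)" by (intro UN_upper UNIV_I)+
    then show ?thesis by simp
  qed
  then have "hausdorff_content f r (A \<union> B) \<le> (\<Sum>i. hausdorff_content f r (?A i))"
    by (rule order_trans[OF hausdorff_content_mono hausdorff_content_UN])
  also have "\<dots> = (\<Sum>i\<in>{0,1}. hausdorff_content f r (?A i))"
    by (rule suminf_finite) (auto simp: hausdorff_content_empty[OF assms])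
  finally show ?thesis by simp
qed

lemma hausdorff_content_UN_finite:
  assumes "finite I" "0 \<le> r"
  shows "hausdorff_content f r (\<Union>i\<in>I. A i) \<le> (\<Sum>i\<in>I. hausdorff_content f r (A i))"
  using assms(1)
proof induction
  case (insert i I)
  have "hausdorff_content f r (\<Union>i\<in>insert i I. A i)
    \<le> hausdorff_content f r (A i) + hausdorff_content f r (\<Union>i\<in>I. A i)"
    using hausdorff_content_Un[OF assms(2)] by simp
  then show ?case using insert by (simp add: add_left_mono order_trans)
qed (simp add: hausdorff_content_empty[OF assms(2)])

lemma hausdorff_measure_eq_0_iff: "hausdorff_measure f A = 0 \<longleftrightarrow> (\<forall>r>0. hausdorff_content f r A = 0)"
  unfolding hausdorff_measure_def le_zero_eq[symmetric] SUP_le_iff by auto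

lemma hausdorff_measure_mono: "A \<subseteq> B \<Longrightarrow> hausdorff_measure f A \<le> hausdorff_measure f B"
  unfolding hausdorff_measure_def by (intro SUP_mono') (auto intro: hausdorff_content_mono)

lemma hausdorff_measure_0_mono: "A \<subseteq> B \<Longrightarrow> hausdorff_measure f B = 0 \<Longrightarrow> hausdorff_measure f A = 0"
  using hausdorff_measure_mono[of A B f] by simp

lemma hausdorff_content_le_measure: "0 < r \<Longrightarrow> hausdorff_content f r A \<le> hausdorff_measure f A"
  unfolding hausdorff_measure_def by (rule SUP_upper) auto

lemma hausdorff_measure_0_UN:
  assumes "\<And>i::nat. hausdorff_measure f (A i) = 0"
  shows "hausdorff_measure f (\<Union>i. A i) = 0"
  unfolding hausdorff_measure_eq_0_iff
proof (intro allI impI)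
  fix r :: real assume "0 < r"
  then have "hausdorff_content f r (A i) = 0" for i using assms hausdorff_measure_eq_0_iff by blast
  then show "hausdorff_content f r (\<Union>i. A i) = 0"
    using hausdorff_content_UN[of f r A] by simp
qed

lemma hausdorff_measure_0_UN_countable:
  assumes "countable I" "\<And>i. i \<in> I \<Longrightarrow> hausdorff_measure f (A i) = 0"
  shows "hausdorff_measure f (\<Union>i\<in>I. A i) = 0"
proof (cases "I = {}")
  case False
  then have "(\<Union>i\<in>I. A i) = (\<Union>n. A (from_nat_into I n))"
    using range_from_nat_into[OF False assms(1)] by (metis image_image)
  then show ?thesis
    using hausdorff_measure_0_UN[of f "\<lambda>n. A (from_nat_into I n)"] assms(2) from_nat_into[OF False] by simp
qed (simp add: hausdorff_measure_eq_0_iff hausdorff_content_empty)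

text \<open>Subadditivity of each content is enough, so no measurability of \<open>A\<close> enters.
  This is how the well approximable set is compared with the whole translate without being shown to
  be Borel.\<close>

lemma hausdorff_measure_Un_null:
  assumes "hausdorff_measure f B = 0"
  shows "hausdorff_measure f (A \<union> B) = hausdorff_measure f A"
proof (rule antisym)
  show "hausdorff_measure f (A \<union> B) \<le> hausdorff_measure f A"
    unfolding hausdorff_measure_def
  proof (rule SUP_mono)
    fix r :: real assume r: "r \<in> {0<..}"
    then have "hausdorff_content f r B = 0" using assms hausdorff_measure_eq_0_iff by auto
    then show "\<exists>m\<in>{0<..}. hausdorff_content f r (A \<union> B) \<le> hausdorff_content f m A"
      using hausdorff_content_Un[of r f A B] r by auto
  qed
qed (simp add: hausdorff_measure_mono)

lemma hausdorff_content_translate_le: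
  "hausdorff_content f r ((\<lambda>t. t - x) ` A) \<le> hausdorff_content f r A"
  unfolding hausdorff_content_def[of f r A]
proof (rule INF_greatest)
  fix U :: "nat \<Rightarrow> real set"
  assume U: "U \<in> {U. A \<subseteq> (\<Union>i. U i) \<and> (\<forall>i. bounded (U i) \<and> diameter (U i) \<le> r)}"
  have eq: "(\<lambda>t. t - x) ` V = (+) (- x) ` V" for V by auto
  have diam: "diameter ((\<lambda>t. t - x) ` V) = diameter V" for V
  proof -
    let ?g = "\<lambda>t. t - x"
    have "?g ` V \<times> ?g ` V = map_prod ?g ?g ` (V \<times> V)" by (simp add: map_prod_image)
    then have "(\<lambda>(x, y). dist x y) ` (?g ` V \<times> ?g ` V) = (\<lambda>(x, y). dist x y) ` (V \<times> V)"
      by (simp only: image_image) (simp add: case_prod_beta dist_norm)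
    then show ?thesis unfolding diameter_def by simp
  qed
  have "hausdorff_content f r ((\<lambda>t. t - x) ` A) \<le> (\<Sum>i. gauge_val f (diameter ((\<lambda>t. t - x) ` U i)))"
  proof (rule hausdorff_content_le_suminf)
    show "(\<lambda>t. t - x) ` A \<subseteq> (\<Union>i. (\<lambda>t. t - x) ` U i)"
      using U image_mono[of A "\<Union>i. U i" "\<lambda>t. t - x"] by (simp add: image_UN)
    show "bounded ((\<lambda>t. t - x) ` U i)" for i using U unfolding eq by (intro bounded_translation) blast
    show "diameter ((\<lambda>t. t - x) ` U i) \<le> r" for i using U unfolding diam by blast
  qed
  then show "hausdorff_content f r ((\<lambda>t. t - x) ` A) \<le> (\<Sum>i. gauge_val f (diameter (U i)))"
    by (simp add: diam)
qed

lemma hausdorff_measure_translate: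
  "hausdorff_measure f ((\<lambda>t. t - x) ` A) = hausdorff_measure f A"
proof -
  have "(\<lambda>t. t - (- x)) ` (\<lambda>t. t - x) ` A = A" by (auto simp: image_image)
  then have "hausdorff_content f r ((\<lambda>t. t - x) ` A) = hausdorff_content f r A" for r
    using hausdorff_content_translate_le[of f r x A]
      hausdorff_content_translate_le[of f r "- x" "(\<lambda>t. t - x) ` A"] by (intro antisym) simp_all
  then show ?thesis unfolding hausdorff_measure_def by simp
qed

text \<open>Closures keep boundedness and diameter. Intersecting over m the unions of the closures
  of covers of cost below \<open>1 / (m+1)\<close> therefore gives a Borel set that is still null.
  It is needed because an \<open>AE\<close> statement asks for a measurable exceptional set.\<close>

lemma hausdorff_null_borel_superset:
  assumes "hausdorff_measure f A = 0"
  obtains B where "B \<in> sets borel" "A \<subseteq> B" "hausdorff_measure f B = 0"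
proof -
  have "\<forall>m. \<exists>U. near_cover f (1 / Suc m) A (ennreal (1 / Suc m)) U"
    using assms by (intro allI ex_near_cover) (simp add: hausdorff_measure_eq_0_iff)
  from choice[OF this] obtain U where
    "\<forall>m. near_cover f (1 / Suc m) A (ennreal (1 / Suc m)) (U m)" ..
  then have nc: "near_cover f (1 / Suc m) A (ennreal (1 / Suc m)) (U m)" for m ..
  note U = near_coverD[OF nc]
  define B where "B = (\<Inter>m. \<Union>j. closure (U m j))"
  have "B \<in> sets borel" unfolding B_def by measurable
  moreover have "A \<subseteq> B"
    unfolding B_def
  proof (rule INT_greatest)
    fix m
    have "(\<Union>j. U m j) \<subseteq> (\<Union>j. closure (U m j))" by (intro UN_mono closure_subset order_refl)
    then show "A \<subseteq> (\<Union>j. closure (U m j))" using U(1)[of m] by (rule order_trans[rotated])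
  qed
  moreover have "hausdorff_content f r B = 0" if r: "0 < r" for r
  proof -
    have "hausdorff_content f r B \<le> ennreal (1 / Suc m)" if m: "1 / Suc m < r" for m
    proof -
      have "hausdorff_content f r B \<le> (\<Sum>j. gauge_val f (diameter (closure (U m j))))"
      proof (rule hausdorff_content_le_suminf)
        show "B \<subseteq> (\<Union>i. closure (U m i))" unfolding B_def by (rule INT_lower) simp
        show "diameter (closure (U m i)) \<le> r" for i
          using U(3)[of m i] m by (simp add: diameter_closure U(2))
      qed (simp add: U(2) bounded_closure)
      also have "\<dots> \<le> ennreal (1 / Suc m)"
        using U(4)[of m] by (simp add: diameter_closure U(2) less_imp_le)
      finally show ?thesis .
    qed
    moreover have "eventually (\<lambda>m. 1 / real (Suc m) < r) sequentially"
      by (rule order_tendstoD(2)[OF LIMSEQ_Suc[OF lim_1_over_n] r])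
    ultimately have "eventually (\<lambda>m. hausdorff_content f r B \<le> ennreal (1 / Suc m)) sequentially"
      by (auto elim: eventually_mono)
    moreover have "(\<lambda>m. ennreal (1 / Suc m)) \<longlonglongrightarrow> ennreal 0"
      by (intro tendsto_ennrealI) (use LIMSEQ_Suc[OF lim_1_over_n] in simp)
    ultimately show ?thesis
      using tendsto_lowerbound[of _ "ennreal 0" sequentially "hausdorff_content f r B"] by simp
  qed
  ultimately show ?thesis using that by (auto simp: hausdorff_measure_eq_0_iff)
qed

text \<open>If the Hausdorff measure were not countably additive on the Borel sets, \<^const>\<open>measure_of\<close>
  would return the zero measure; a null set is null in either case.\<close>

lemma AE_normalized_hausdorff:
  assumes "hausdorff_measure (\<lambda>t. t powr s) A = 0" "\<And>x. x \<notin> A \<Longrightarrow> P x"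
  shows "AE x in normalized_hausdorff s J. P x"
proof -
  let ?f = "\<lambda>t. t powr s" and ?H = "hausdorff_meas (\<lambda>t. t powr s)"
  obtain B where B: "B \<in> sets borel" "A \<subseteq> B" "hausdorff_measure ?f B = 0"
    using hausdorff_null_borel_superset[OF assms(1)] .
  have sH: "sets ?H = sets borel"
    unfolding hausdorff_meas_def using sets.sets_measure_of_eq[of "borel :: real measure"] by simp
  have "emeasure ?H B = 0"
    unfolding hausdorff_meas_def emeasure_measure_of_conv using B by simp
  then have nH: "B \<in> null_sets ?H" using B sH by (simp add: null_sets_def)
  have "(\<integral>\<^sup>+ x. indicator J x * indicator B x \<partial>?H) = (\<integral>\<^sup>+ x. 0 \<partial>?H)"
    by (rule nn_integral_cong_AE) (use AE_not_in[OF nH] in eventually_elim, auto)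
  then have "emeasure (density ?H (indicator J)) B = 0"
    unfolding density_def emeasure_measure_of_conv by simp
  then have "emeasure (normalized_hausdorff s J) B = 0"
    unfolding normalized_hausdorff_def by simp
  moreover have "B \<in> sets (normalized_hausdorff s J)"
    unfolding normalized_hausdorff_def using B sH by simp
  ultimately show ?thesis using assms(2) B(2) by (intro AE_I[of _ _ B]) auto
qed

section \<open>Digit sequences, their base-d values, and counting of words\<close>

locale digit_system =
  fixes d :: nat and E :: "nat set"
  assumes d_ge: "2 \<le> d" and E_less: "E \<subseteq> {..<d}" and card_E: "2 \<le> card E"
begin

abbreviation "N \<equiv> card E"

lemma finite_E: "finite E"
  using card_E card.infinite by fastforce

lemma N_pos: "0 < real N" and N_gt1: "1 < real N"
  using card_E by auto

lemma d_pos: "0 < real d" and d_gt1: "1 < real d"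
  using d_ge by auto

lemma exists_other: "\<exists>e\<in>E. e \<noteq> c"
proof (rule ccontr)
  assume "\<not> ?thesis"
  then have "E \<subseteq> {c}" by auto
  then have "card E \<le> 1" using card_mono[of "{c}" E] by simp
  then show False using card_E by simp
qed

definition seqs :: "(nat \<Rightarrow> nat) set" where "seqs = {a. \<forall>i. a i \<in> E}"

definition ev :: "(nat \<Rightarrow> nat) \<Rightarrow> real" where "ev a = (\<Sum>i. real (a i) / real d ^ Suc i)"

definition tail :: "nat \<Rightarrow> (nat \<Rightarrow> nat) \<Rightarrow> nat \<Rightarrow> nat" where "tail k a = (\<lambda>i. a (i + k))"

definition pre :: "nat \<Rightarrow> (nat \<Rightarrow> nat) \<Rightarrow> nat list" where "pre k a = map a [0..<k]"

text \<open>The integer with base-d digits \<open>w\<close>, most significant first (Horner scheme);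
  \<open>hval (pre k a) / d ^ k\<close> is the truncation of \<open>ev a\<close> after k
  digits.\<close>

definition hval :: "nat list \<Rightarrow> nat" where "hval w = foldl (\<lambda>z e. d * z + e) 0 w"

definition words :: "nat \<Rightarrow> nat list set" where "words k = {w. set w \<subseteq> E \<and> length w = k}"

lemma seqs_mem: "a \<in> seqs \<Longrightarrow> a i \<in> E" and seqs_less: "a \<in> seqs \<Longrightarrow> a i < d"
  using E_less by (auto simp: seqs_def)

lemma seqs_le: "a \<in> seqs \<Longrightarrow> real (a i) \<le> real d - 1"
  using seqs_less[of a i] by linarith

lemma tail_seqs: "a \<in> seqs \<Longrightarrow> tail k a \<in> seqs"
  by (auto simp: seqs_def tail_def)

lemma tail_tail: "tail k (tail l a) = tail (k + l) a"
  by (auto simp: tail_def add.assoc)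

lemma length_pre [simp]: "length (pre k a) = k"
  by (simp add: pre_def)

lemma nth_pre: "i < k \<Longrightarrow> pre k a ! i = a i"
  by (simp add: pre_def)

lemma pre_Suc: "pre (Suc k) a = pre k a @ [a k]"
  by (simp add: pre_def)

lemma pre_words: "a \<in> seqs \<Longrightarrow> pre k a \<in> words k"
  by (auto simp: seqs_def pre_def words_def)

lemma take_pre: "k \<le> l \<Longrightarrow> take k (pre l a) = pre k a"
  by (simp add: pre_def take_map)

lemma hval_Nil [simp]: "hval [] = 0" and hval_snoc [simp]: "hval (w @ [e]) = d * hval w + e"
  by (simp_all add: hval_def)

lemma geometric_digits: "(\<lambda>i. (real d - 1) / real d ^ Suc i) sums 1"
proof -
  have "(\<lambda>i. ((real d - 1) / real d) * (1 / real d) ^ i) sums (((real d - 1) / real d) * (1 / (1 - 1 / real d)))"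
    using d_gt1 by (intro sums_mult geometric_sums) simp
  also have "((real d - 1) / real d) * (1 / (1 - 1 / real d)) = 1"
    using d_gt1 by (simp add: field_simps)
  also have "(\<lambda>i. ((real d - 1) / real d) * (1 / real d) ^ i) = (\<lambda>i. (real d - 1) / real d ^ Suc i)"
    by (simp add: power_divide)
  finally show ?thesis .
qed

lemma summable_ev: 
  assumes "a \<in> seqs" shows "summable (\<lambda>i. real (a i) / real d ^ Suc i)"
proof (rule summable_comparison_test')
  show "summable (\<lambda>i. (real d - 1) / real d ^ Suc i)" using geometric_digits sums_summable by blast
  show "norm (real (a i) / real d ^ Suc i) \<le> (real d - 1) / real d ^ Suc i" for i
    using seqs_le[OF assms, of i] d_pos by (simp add: divide_right_mono)
qed

lemma ev_nonneg: "a \<in> seqs \<Longrightarrow> 0 \<le> ev a"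
  unfolding ev_def by (intro suminf_nonneg summable_ev) auto

lemma ev_le_1:
  assumes "a \<in> seqs" shows "ev a \<le> 1"
proof -
  have "ev a \<le> (\<Sum>i. (real d - 1) / real d ^ Suc i)"
    unfolding ev_def using geometric_digits sums_summable seqs_le[OF assms]
    by (intro suminf_le summable_ev assms divide_right_mono) auto
  then show ?thesis using geometric_digits sums_unique by metis
qed

lemma digit_set_eq: "digit_set d E = ev ` seqs"
proof -
  have "x \<in> digit_set d E \<longleftrightarrow> x \<in> {0..1} \<and> (\<exists>a\<in>seqs. x = ev a)" for x
    unfolding digit_set_def seqs_def ev_def by auto
  then show ?thesis using ev_nonneg ev_le_1 by auto
qed

lemma ev_step:
  assumes "a \<in> seqs" shows "real d * ev a = real (a 0) + ev (tail 1 a)"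
proof -
  have "ev a = real (a 0) / real d ^ Suc 0 + (\<Sum>i. real (a (Suc i)) / real d ^ Suc (Suc i))"
    unfolding ev_def using suminf_split_head[OF summable_ev[OF assms]] by simp
  also have "(\<Sum>i. real (a (Suc i)) / real d ^ Suc (Suc i)) = (\<Sum>i. (1 / real d) * (real (tail 1 a i) / real d ^ Suc i))"
    by (simp add: tail_def)
  also have "\<dots> = (1 / real d) * ev (tail 1 a)"
    unfolding ev_def by (rule suminf_mult) (rule summable_ev[OF tail_seqs[OF assms]])
  finally show ?thesis using d_pos by (simp add: field_simps)
qed

text \<open>Moving the radix point by k places separates an integer from a remainder in [0,1]. The
  remainder can be 1, which is why carries have to be controlled later.\<close>

lemma ev_split:
  assumes "a \<in> seqs" shows "real d ^ k * ev a = real (hval (pre k a)) + ev (tail k a)"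
proof (induction k)
  case 0 show ?case by (simp add: pre_def tail_def)
next
  case (Suc k)
  have "real d ^ Suc k * ev a = real d * real (hval (pre k a)) + real d * ev (tail k a)"
    using arg_cong[OF Suc, of "\<lambda>z. real d * z"] by (simp add: distrib_left mult.assoc)
  also have "real d * ev (tail k a) = real (a k) + ev (tail (Suc k) a)"
    using ev_step[OF tail_seqs[OF assms, of k]] by (simp add: tail_tail) (simp add: tail_def)
  finally show ?case by (simp add: pre_Suc)
qed

lemma ev_eq: "a \<in> seqs \<Longrightarrow> ev a = real (hval (pre k a)) / real d ^ k + ev (tail k a) / real d ^ k"
  using ev_split[of a k] d_pos by (simp add: field_simps)

lemma ev_bounds:
  assumes "a \<in> seqs"
  shows "real (hval (pre k a)) / real d ^ k \<le> ev a" "ev a \<le> (real (hval (pre k a)) + 1) / real d ^ k"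
  using ev_eq[OF assms, of k] ev_nonneg[OF tail_seqs[OF assms]] ev_le_1[OF tail_seqs[OF assms]] d_pos
  by (auto simp: add_divide_distrib divide_right_mono)

lemma ev_dist:
  assumes "a \<in> seqs" "b \<in> seqs" "\<And>i. i < k \<Longrightarrow> a i = b i"
  shows "\<bar>ev a - ev b\<bar> \<le> 1 / real d ^ k"
proof -
  have "pre k a = pre k b" using assms(3) by (simp add: pre_def)
  then show ?thesis using ev_bounds[OF assms(1), of k] ev_bounds[OF assms(2), of k]
    by (simp add: add_divide_distrib)
qed

lemma words_Suc: "words (Suc k) = (\<lambda>(w, e). w @ [e]) ` (words k \<times> E)"
proof
  show "words (Suc k) \<subseteq> (\<lambda>(w, e). w @ [e]) ` (words k \<times> E)"
  proof
    fix v assume v: "v \<in> words (Suc k)"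
    then have "v \<noteq> []" by (auto simp: words_def)
    then obtain w e where "v = w @ [e]" by (metis append_butlast_last_id)
    then show "v \<in> (\<lambda>(w, e). w @ [e]) ` (words k \<times> E)" using v by (auto simp: words_def)
  qed
qed (auto simp: words_def)

lemma finite_words: "finite (words k)"
  unfolding words_def by (rule finite_lists_length_eq[OF finite_E])

lemma card_words: "card (words k) = N ^ k"
  unfolding words_def by (rule card_lists_length_eq[OF finite_E])

lemma words_length: "w \<in> words k \<Longrightarrow> length w = k"
  by (simp add: words_def)

text \<open>The last digit is the residue modulo d. Injectivity turns counting words into counting
  integers in an interval.\<close>

lemma hval_inj: "inj_on hval (words k)"
proof (induction k)
  case 0 show ?case by (auto simp: words_def inj_on_def)
next
  case (Suc k)
  show ?case
  proof (rule inj_onI)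
    fix v v' assume "v \<in> words (Suc k)" "v' \<in> words (Suc k)" and eq: "hval v = hval v'"
    then obtain w e w' e' where w: "v = w @ [e]" "v' = w' @ [e']" "w \<in> words k" "w' \<in> words k" "e \<in> E" "e' \<in> E"
      unfolding words_Suc by auto
    have less: "e < d" "e' < d" using w E_less by auto
    have eq': "d * hval w + e = d * hval w' + e'" using eq w by simp
    have "e = e'" using arg_cong[OF eq', of "\<lambda>z. z mod d"] less by simp
    moreover from this eq' d_ge have "hval w = hval w'" by simp
    ultimately show "v = v'" using Suc w by (auto dest: inj_onD)
  qed
qed

text \<open>Every prescribed letter divides the number of words by \<open>N\<close>; the product
  form avoids division in nat. The induction splits off the last letter, whose choices
  \<open>?F\<close> number 1 or \<open>N\<close>.\<close>

lemma card_words_fixed: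
  assumes "S \<subseteq> {..<k}" "\<And>i. i \<in> S \<Longrightarrow> c i \<in> E"
  shows "card {w \<in> words k. \<forall>i\<in>S. w ! i = c i} * N ^ card S = N ^ k"
  using assms
proof (induction k arbitrary: S)
  case 0
  then have "{w \<in> words 0. \<forall>i\<in>S. w ! i = c i} = {[]}" by (auto simp: words_def)
  then show ?case using 0 by simp
next
  case (Suc k)
  let ?S = "S \<inter> {..<k}" and ?F = "if k \<in> S then {c k} else E"
  let ?W = "{w \<in> words k. \<forall>i\<in>?S. w ! i = c i}"
  have fin: "finite S" using Suc.prems(1) finite_subset by blast
  have cases: "i \<in> S \<longleftrightarrow> i \<in> ?S \<or> (i = k \<and> k \<in> S)" for i using Suc.prems(1) by (auto simp: less_Suc_eq)
  have 1: "(\<forall>i\<in>S. (w @ [e]) ! i = c i) \<longleftrightarrow> (\<forall>i\<in>?S. w ! i = c i) \<and> (k \<in> S \<longrightarrow> e = c k)" if "length w = k" for w e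
  proof -
    have "(\<forall>i\<in>S. (w @ [e]) ! i = c i) \<longleftrightarrow> (\<forall>i\<in>?S. (w @ [e]) ! i = c i) \<and> (k \<in> S \<longrightarrow> (w @ [e]) ! k = c k)"
      using cases by blast
    also have "(\<forall>i\<in>?S. (w @ [e]) ! i = c i) \<longleftrightarrow> (\<forall>i\<in>?S. w ! i = c i)"
      by (rule ball_cong) (use that in \<open>auto simp: nth_append\<close>)
    finally show ?thesis using that by (auto simp: nth_append)
  qed
  have "{w \<in> words (Suc k). \<forall>i\<in>S. w ! i = c i} = (\<lambda>(w, e). w @ [e]) ` (?W \<times> ?F)"
  proof (intro equalityI subsetI)
    fix v assume v: "v \<in> {w \<in> words (Suc k). \<forall>i\<in>S. w ! i = c i}"
    then obtain w e where w: "v = w @ [e]" "w \<in> words k" "e \<in> E" unfolding words_Suc by auto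
    then have "w \<in> ?W" "e \<in> ?F" using 1[of w e] v by (auto simp: words_length)
    then show "v \<in> (\<lambda>(w, e). w @ [e]) ` (?W \<times> ?F)" using w by auto
  next
    fix v assume "v \<in> (\<lambda>(w, e). w @ [e]) ` (?W \<times> ?F)"
    then obtain w e where w: "v = w @ [e]" "w \<in> ?W" "e \<in> ?F" by auto
    then have "e \<in> E" using Suc.prems(2) by (auto split: if_splits)
    then show "v \<in> {w \<in> words (Suc k). \<forall>i\<in>S. w ! i = c i}"
      using w 1[of w e] unfolding words_Suc by (auto simp: words_length split: if_splits)
  qed
  moreover have "inj_on (\<lambda>(w, e). w @ [e]) (?W \<times> ?F)" by (auto simp: inj_on_def)
  ultimately have "card {w \<in> words (Suc k). \<forall>i\<in>S. w ! i = c i} = card ?W * card ?F"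
    by (simp only: card_image card_cartesian_product)
  moreover have "card ?W * N ^ card ?S = N ^ k" by (rule Suc.IH) (use Suc.prems in auto)
  moreover have "card ?F * N ^ card S = N * N ^ card ?S"
  proof (cases "k \<in> S")
    case True
    then have "S = insert k ?S" using Suc.prems(1) by (auto simp: less_Suc_eq)
    moreover have "card (insert k ?S) = Suc (card ?S)" using fin by simp
    ultimately have "card S = Suc (card ?S)" by simp
    then show ?thesis using True by simp
  next
    case False
    then have "?S = S" using Suc.prems(1) by (auto simp: less_Suc_eq)
    then show ?thesis using False by simp
  qed
  ultimately show ?case by (simp add: mult.assoc)
qed

lemma card_words_fixed_real:
  assumes "S \<subseteq> {..<k}" "\<And>i. i \<in> S \<Longrightarrow> c i \<in> E"
  shows "real (card {w \<in> words k. \<forall>i\<in>S. w ! i = c i}) = real N ^ k / real N ^ card S"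
proof -
  have "real (card {w \<in> words k. \<forall>i\<in>S. w ! i = c i}) * real N ^ card S = real N ^ k"
    using arg_cong[where f = real, OF card_words_fixed[OF assms]] by simp
  then show ?thesis using N_pos by (simp add: field_simps)
qed

text \<open>The similarity dimension. What is used of it is that d to the power \<open>delta\<close>
  is \<open>N\<close>; \<open>hausdorff_dim_digit_set\<close> identifies it with the Hausdorff
  dimension.\<close>

definition delta :: real where "delta = ln (real N) / ln (real d)"

lemma delta_pos: "0 < delta"
  unfolding delta_def using N_gt1 d_gt1 by simp

lemma powr_delta: "(real d ^ n) powr delta = real N ^ n"
proof -
  have "real d powr delta = real N" using d_gt1 N_pos by (simp add: delta_def powr_def)
  then have "(real d powr delta) ^ n = real N ^ n" by simp
  moreover have "(real d ^ n) powr delta = (real d powr delta) ^ n"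
    using d_pos by (simp add: powr_realpow[symmetric] powr_powr mult.commute)
  ultimately show ?thesis by simp
qed

lemma inverse_powr_delta: "(1 / real d ^ n) powr delta = 1 / real N ^ n"
  using d_pos by (simp add: powr_divide powr_delta)

end

section \<open>Second moments: sequences that avoid a divergent family of blocks\<close>

text \<open>Chebyshev's inequality for the number of events that occur: without positive correlations
  the variance of that number is at most its mean.\<close>

lemma card_avoid_all_le:
  fixes A :: "nat \<Rightarrow> 'a set" and p :: "nat \<Rightarrow> real"
  assumes fin: "finite \<Omega>" and sub: "\<And>n. n < M \<Longrightarrow> A n \<subseteq> \<Omega>"
    and single: "\<And>n. n < M \<Longrightarrow> real (card (A n)) = real (card \<Omega>) * p n"
    and pair: "\<And>n m. n < m \<Longrightarrow> m < M \<Longrightarrow> real (card (A n \<inter> A m)) \<le> real (card \<Omega>) * (p n * p m)"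
  shows "real (card {w \<in> \<Omega>. \<forall>n<M. w \<notin> A n}) * (\<Sum>n<M. p n)\<^sup>2 \<le> real (card \<Omega>) * (\<Sum>n<M. p n)"
proof -
  define s where "s = (\<Sum>n<M. p n)"
  define K where "K = real (card \<Omega>)"
  define Y where "Y w = (\<Sum>n<M. indicat_real (A n) w)" for w
  have ind: "(\<Sum>w\<in>\<Omega>. indicat_real X w) = real (card X)" if "X \<subseteq> \<Omega>" for X
    using that fin by (simp add: indicator_def sum_of_bool_eq Int_absorb1)
  \<comment> \<open>On the diagonal no decorrelation is available, and the extra term there is what
    sums to the mean.\<close>
  have pair': "(\<Sum>w\<in>\<Omega>. indicat_real (A n) w * indicat_real (A m) w) \<le> K * (p n * p m) + (if n = m then K * p n else 0)"
    if "n < M" "m < M" for n m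
  proof -
    have eq: "(\<Sum>w\<in>\<Omega>. indicat_real (A n) w * indicat_real (A m) w) = real (card (A n \<inter> A m))"
      using ind[of "A n \<inter> A m"] sub[OF that(1)] by (simp add: indicator_inter_arith le_infI1)
    consider "n = m" | "n < m" | "m < n" by linarith
    then show ?thesis
    proof cases
      case 1
      have "0 \<le> K * (p n * p n)" by (simp add: K_def)
      then show ?thesis using 1 eq single[OF that(1)] by (simp add: K_def)
    next
      case 2 then show ?thesis using eq pair[of n m] that by (simp add: K_def)
    next
      case 3 then show ?thesis using eq pair[of m n] that by (simp add: K_def Int_commute mult.commute[of "p n"])
    qed
  qed
  have EY: "(\<Sum>w\<in>\<Omega>. Y w) = K * s"
  proof -
    have "(\<Sum>w\<in>\<Omega>. Y w) = (\<Sum>n<M. \<Sum>w\<in>\<Omega>. indicat_real (A n) w)"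
      unfolding Y_def by (rule sum.swap)
    also have "\<dots> = (\<Sum>n<M. K * p n)"
      by (intro sum.cong refl) (simp add: ind sub single K_def)
    finally show ?thesis by (simp add: s_def sum_distrib_left)
  qed
  have EY2: "(\<Sum>w\<in>\<Omega>. (Y w)\<^sup>2) \<le> K * s\<^sup>2 + K * s"
  proof -
    have "(\<Sum>w\<in>\<Omega>. (Y w)\<^sup>2) = (\<Sum>w\<in>\<Omega>. \<Sum>n<M. \<Sum>m<M. indicat_real (A n) w * indicat_real (A m) w)"
      unfolding Y_def power2_eq_square by (simp add: sum_product)
    also have "\<dots> = (\<Sum>n<M. \<Sum>w\<in>\<Omega>. \<Sum>m<M. indicat_real (A n) w * indicat_real (A m) w)"
      by (rule sum.swap)
    also have "\<dots> = (\<Sum>n<M. \<Sum>m<M. \<Sum>w\<in>\<Omega>. indicat_real (A n) w * indicat_real (A m) w)"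
      by (intro sum.cong refl sum.swap)
    also have "\<dots> \<le> (\<Sum>n<M. \<Sum>m<M. K * (p n * p m) + (if n = m then K * p n else 0))"
      by (intro sum_mono pair') auto
    also have "\<dots> = (\<Sum>n<M. \<Sum>m<M. K * (p n * p m)) + (\<Sum>n<M. K * p n)"
      by (simp add: sum.distrib)
    also have "(\<Sum>n<M. \<Sum>m<M. K * (p n * p m)) = K * s\<^sup>2"
      unfolding s_def power2_eq_square sum_product by (simp add: sum_distrib_left)
    also have "(\<Sum>n<M. K * p n) = K * s" by (simp add: s_def sum_distrib_left)
    finally show ?thesis .
  qed
  let ?B = "{w \<in> \<Omega>. \<forall>n<M. w \<notin> A n}"
  \<comment> \<open>On \<open>?B\<close> no event occurs, so \<open>Y w = 0\<close> and every
    summand is the square of \<open>s\<close>.\<close>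
  have "real (card ?B) * s\<^sup>2 = (\<Sum>w\<in>?B. (Y w - s)\<^sup>2)"
    by (simp add: Y_def)
  also have "\<dots> \<le> (\<Sum>w\<in>\<Omega>. (Y w - s)\<^sup>2)"
    by (rule sum_mono2) (use fin in auto)
  also have "\<dots> = (\<Sum>w\<in>\<Omega>. (Y w)\<^sup>2 + s\<^sup>2 - 2 * s * Y w)"
    by (intro sum.cong refl) (simp add: power2_diff algebra_simps)
  also have "\<dots> = (\<Sum>w\<in>\<Omega>. (Y w)\<^sup>2) + K * s\<^sup>2 - 2 * s * (\<Sum>w\<in>\<Omega>. Y w)"
    by (simp add: sum.distrib sum_subtractf sum_distrib_left[symmetric] K_def)
  also have "\<dots> \<le> K * s"
    unfolding EY using EY2 by (simp add: power2_eq_square algebra_simps)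
  finally show ?thesis unfolding s_def K_def .
qed

lemma not_summable_partial_sum_gt:
  fixes p :: "nat \<Rightarrow> real"
  assumes "\<not> summable p" "\<And>n. 0 \<le> p n"
  shows "\<exists>M. c < (\<Sum>n<M. p n)"
  using assms summableI_nonneg_bounded[of p c] by (meson linorder_not_le)

text \<open>Letters are read through a function, so that one notion serves infinite sequences and,
  in the form \<open>occ ((!) w)\<close>, finite words long enough to contain the block.\<close>

definition occ :: "(nat \<Rightarrow> nat) \<Rightarrow> nat \<Rightarrow> nat list \<Rightarrow> bool" where
  "occ a k u \<longleftrightarrow> (\<forall>i<length u. a (k + i) = u ! i)"

context digit_system
begin

lemma card_occ:
  assumes "set u \<subseteq> E" "k + length u \<le> l"
  shows "real (card {w \<in> words l. occ ((!) w) k u}) = real N ^ l * (1 / real N ^ length u)"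
proof -
  have eq: "occ ((!) w) k u \<longleftrightarrow> (\<forall>i\<in>{k..<k + length u}. w ! i = u ! (i - k))" for w
  proof
    assume L: "occ ((!) w) k u"
    show "\<forall>i\<in>{k..<k + length u}. w ! i = u ! (i - k)"
    proof
      fix i assume "i \<in> {k..<k + length u}"
      then show "w ! i = u ! (i - k)" using L unfolding occ_def by (auto dest: spec[of _ "i - k"])
    qed
  next
    assume R: "\<forall>i\<in>{k..<k + length u}. w ! i = u ! (i - k)"
    show "occ ((!) w) k u" unfolding occ_def
    proof (intro allI impI)
      fix i assume "i < length u"
      then show "w ! (k + i) = u ! i" using bspec[OF R, of "k + i"] by simp
    qed
  qed
  show ?thesis unfolding eq
    by (subst card_words_fixed_real) (use assms in \<open>auto intro!: subsetD[OF assms(1)] nth_mem\<close>)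
qed

text \<open>Blocks on disjoint places are independent: both prescriptions merge into one,
  \<open>?c\<close> on \<open>?S\<close>, which is counted at once.\<close>

lemma card_occ2:
  assumes "set u \<subseteq> E" "set v \<subseteq> E" "k + length u \<le> k'" "k' + length v \<le> l"
  shows "real (card {w \<in> words l. occ ((!) w) k u \<and> occ ((!) w) k' v})
    = real N ^ l * (1 / real N ^ length u * (1 / real N ^ length v))"
proof -
  let ?c = "\<lambda>i. if i < k' then u ! (i - k) else v ! (i - k')"
  let ?S = "{k..<k + length u} \<union> {k'..<k' + length v}"
  have eq: "occ ((!) w) k u \<and> occ ((!) w) k' v \<longleftrightarrow> (\<forall>i\<in>?S. w ! i = ?c i)" for w
  proof
    assume L: "occ ((!) w) k u \<and> occ ((!) w) k' v"
    show "\<forall>i\<in>?S. w ! i = ?c i"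
    proof
      fix i assume "i \<in> ?S"
      then consider "k \<le> i" "i < k + length u" | "k' \<le> i" "i < k' + length v" by auto
      then show "w ! i = ?c i"
      proof cases
        case 1 then show ?thesis using L assms(3) unfolding occ_def by (auto dest: spec[of _ "i - k"])
      next
        case 2 then show ?thesis using L unfolding occ_def by (auto dest: spec[of _ "i - k'"])
      qed
    qed
  next
    assume R: "\<forall>i\<in>?S. w ! i = ?c i"
    show "occ ((!) w) k u \<and> occ ((!) w) k' v" unfolding occ_def
    proof (intro conjI allI impI)
      fix i assume "i < length u"
      then show "w ! (k + i) = u ! i" using bspec[OF R, of "k + i"] assms(3) by simp
    next
      fix i assume "i < length v"
      then show "w ! (k' + i) = v ! i" using bspec[OF R, of "k' + i"] by simp
    qed
  qed
  have "card ?S = length u + length v" using assms(3) by (subst card_Un_disjoint) auto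
  moreover have "?c i \<in> E" if "i \<in> ?S" for i
  proof (cases "i < k'")
    case True
    then have "u ! (i - k) \<in> set u" using that by (intro nth_mem) auto
    then show ?thesis using True assms(1) by auto
  next
    case False
    then have "v ! (i - k') \<in> set v" using that assms(3) by (intro nth_mem) auto
    then show ?thesis using False assms(2) by auto
  qed
  moreover have "?S \<subseteq> {..<l}" using assms(3,4) by auto
  ultimately have "real (card {w \<in> words l. \<forall>i\<in>?S. w ! i = ?c i}) = real N ^ l / real N ^ (length u + length v)"
    using card_words_fixed_real[of ?S l ?c] by simp
  then show ?thesis unfolding eq by (simp add: power_add)
qed

definition cylinder :: "nat \<Rightarrow> nat list \<Rightarrow> real set" where
  "cylinder k w = {real (hval w) / real d ^ k .. (real (hval w) + 1) / real d ^ k}"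

lemma ev_in_cylinder: "a \<in> seqs \<Longrightarrow> ev a \<in> cylinder k (pre k a)"
  using ev_bounds by (simp add: cylinder_def)

lemma diameter_cylinder: "diameter (cylinder k w) = 1 / real d ^ k"
proof -
  have "real (hval w) / real d ^ k \<le> (real (hval w) + 1) / real d ^ k"
    using d_pos by (simp add: divide_right_mono)
  then show ?thesis unfolding cylinder_def by (simp add: diameter_closed_interval add_divide_distrib)
qed

lemma inverse_power_small: "0 < r \<Longrightarrow> \<exists>k\<ge>l. 1 / real d ^ k < r"
proof -
  assume r: "0 < r"
  have "1 / real d < 1" using d_gt1 by simp
  then obtain k where "(1 / real d) ^ k < r" using r real_arch_pow_inv by blast
  moreover have "(1 / real d) ^ max k l \<le> (1 / real d) ^ k"
    using d_gt1 by (intro power_decreasing) auto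
  ultimately show ?thesis by (intro exI[of _ "max k l"]) (auto simp: power_divide)
qed

text \<open>A Borel-Cantelli lemma for covers. If \<sigma> is the sum of the first M probabilities,
  at most \<open>N^l / \<sigma>\<close> words of length l avoid the first M blocks; each cylinder
  costs at most \<open>C / N^l\<close>, so the total is at most \<open>C / \<sigma>\<close>, and
  \<sigma> is unbounded. Hypothesis \<open>sep\<close> says that two blocks either occupy disjoint
  places or exclude each other, so that their correlation is never positive.\<close>

lemma hausdorff_null_avoid_blocks:
  fixes s :: "nat \<Rightarrow> nat" and z :: "nat \<Rightarrow> nat list"
  assumes z: "\<And>n. set (z n) \<subseteq> E"
    and sep: "\<And>n m. n < m \<Longrightarrow> s n + length (z n) \<le> s m \<or> (\<forall>a. \<not> (occ a (s n) (z n) \<and> occ a (s m) (z m)))"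
    and div: "\<not> summable (\<lambda>n. 1 / real N ^ length (z n))"
    and f: "\<And>t. 0 < t \<Longrightarrow> t \<le> 1 \<Longrightarrow> f t \<le> C * t powr delta" and C: "0 \<le> C"
  shows "hausdorff_measure f (ev ` {a \<in> seqs. \<forall>n. \<not> occ a (s n) (z n)}) = 0"
  unfolding hausdorff_measure_eq_0_iff
proof (intro allI impI)
  fix r :: real assume r: "0 < r"
  let ?T = "{a \<in> seqs. \<forall>n. \<not> occ a (s n) (z n)}"
  have "hausdorff_content f r (ev ` ?T) \<le> 0 + ennreal \<epsilon>" if eps: "0 < \<epsilon>" for \<epsilon>
  proof -
    define p where "p n = 1 / real N ^ length (z n)" for n
    \<comment> \<open>The summand 1 keeps \<sigma> positive even when \<open>C = 0\<close>.\<close>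
    obtain M where M: "C / \<epsilon> + 1 < (\<Sum>n<M. p n)"
      using not_summable_partial_sum_gt[of p "C / \<epsilon> + 1"] div unfolding p_def by auto
    define \<sigma> where "\<sigma> = (\<Sum>n<M. p n)"
    have "0 \<le> C / \<epsilon>" using C eps by simp
    then have sg: "0 < \<sigma>" "C / \<epsilon> < \<sigma>" using M unfolding \<sigma>_def by linarith+
    \<comment> \<open>The sum of all end places is a crude length that contains every one of the
      first M blocks.\<close>
    obtain l where l: "l \<ge> (\<Sum>n<M. s n + length (z n))" "1 / real d ^ l < r"
      using inverse_power_small[OF r] by blast
    have fit: "s n + length (z n) \<le> l" if "n < M" for n
      using member_le_sum[of n "{..<M}" "\<lambda>n. s n + length (z n)"] that l(1) by simp
    define B where "B = {w \<in> words l. \<forall>n<M. w \<notin> {w \<in> words l. occ ((!) w) (s n) (z n)}}"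
    have "real (card B) * \<sigma>\<^sup>2 \<le> real (card (words l)) * \<sigma>"
      unfolding B_def \<sigma>_def
    proof (rule card_avoid_all_le)
      fix n assume n: "n < M"
      show "real (card {w \<in> words l. occ ((!) w) (s n) (z n)}) = real (card (words l)) * p n"
        using card_occ[OF z fit[OF n]] by (simp add: card_words p_def)
    next
      fix n m assume nm: "n < m" "m < M"
      let ?A = "\<lambda>n. {w \<in> words l. occ ((!) w) (s n) (z n)}"
      have eq: "?A n \<inter> ?A m = {w \<in> words l. occ ((!) w) (s n) (z n) \<and> occ ((!) w) (s m) (z m)}" by auto
      show "real (card (?A n \<inter> ?A m)) \<le> real (card (words l)) * (p n * p m)"
        using sep[OF nm(1)]
      proof
        assume "s n + length (z n) \<le> s m"
        then show ?thesis unfolding eq using card_occ2[OF z z _ fit[OF nm(2)], of "s n" n]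
          by (simp add: card_words p_def)
      next
        assume "\<forall>a. \<not> (occ a (s n) (z n) \<and> occ a (s m) (z m))"
        then have "?A n \<inter> ?A m = {}" unfolding eq by simp
        then show ?thesis by (simp add: p_def)
      qed
    qed (auto simp: finite_words)
    then have cB: "real (card B) \<le> real N ^ l / \<sigma>"
      using sg by (simp add: card_words power2_eq_square field_simps)
    have "ev ` ?T \<subseteq> (\<Union>w\<in>B. cylinder l w)"
    proof
      fix y assume "y \<in> ev ` ?T"
      then obtain a where a: "a \<in> seqs" "\<And>n. \<not> occ a (s n) (z n)" "y = ev a" by auto
      have "occ ((!) (pre l a)) (s n) (z n) \<longleftrightarrow> occ a (s n) (z n)" if "n < M" for n
        using fit[OF that] unfolding occ_def by (simp add: nth_pre)
      then have "pre l a \<in> B" using a pre_words unfolding B_def by simp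
      then show "y \<in> (\<Union>w\<in>B. cylinder l w)" using ev_in_cylinder[OF a(1)] a(3) by blast
    qed
    then have "hausdorff_content f r (ev ` ?T) \<le> hausdorff_content f r (\<Union>w\<in>B. cylinder l w)"
      by (rule hausdorff_content_mono)
    also have "\<dots> \<le> (\<Sum>w\<in>B. hausdorff_content f r (cylinder l w))"
      by (rule hausdorff_content_UN_finite) (use r finite_words in \<open>auto simp: B_def\<close>)
    also have "\<dots> \<le> (\<Sum>w\<in>B. ennreal (C / real N ^ l))"
    proof (rule sum_mono)
      fix w
      have "hausdorff_content f r (cylinder l w) \<le> gauge_val f (diameter (cylinder l w))"
        by (rule hausdorff_content_le[OF order_refl])
          (use l r in \<open>simp_all add: diameter_cylinder\<close>, simp add: cylinder_def)
      also have "\<dots> = ennreal (f (1 / real d ^ l))"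
        using d_pos by (simp add: diameter_cylinder gauge_val_def)
      also have "\<dots> \<le> ennreal (C / real N ^ l)"
        using f[of "1 / real d ^ l"] d_gt1 by (intro ennreal_leI) (simp add: inverse_powr_delta)
      finally show "hausdorff_content f r (cylinder l w) \<le> ennreal (C / real N ^ l)" .
    qed
    also have "\<dots> = ennreal (real (card B) * (C / real N ^ l))"
      using C by (subst ennreal_mult) (auto simp: ennreal_of_nat_eq_real_of_nat)
    also have "\<dots> \<le> ennreal \<epsilon>"
    proof (rule ennreal_leI)
      have "real (card B) * (C / real N ^ l) \<le> (real N ^ l / \<sigma>) * (C / real N ^ l)"
        using cB C by (intro mult_right_mono) auto
      also have "\<dots> = C / \<sigma>" using zero_less_power[OF N_pos, of l] by simp
      also have "\<dots> \<le> \<epsilon>" using sg eps by (simp add: pos_divide_less_eq pos_divide_le_eq mult.commute)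
      finally show "real (card B) * (C / real N ^ l) \<le> \<epsilon>" .
    qed
    finally show ?thesis by simp
  qed
  note bound = this
  have "hausdorff_content f r (ev ` ?T) \<le> 0" by (rule ennreal_le_epsilon) (rule bound)
  then show "hausdorff_content f r (ev ` ?T) = 0" by simp
qed


section \<open>Covers as weights on the tree of words; infinite measure in the unbounded
  case\<close>

text \<open>After scaling by \<open>d^k\<close> the points of \<open>U\<close> are within d of each
  other, and each exceeds its \<open>hval\<close> by at most 1. So all these integers are within
  \<open>d + 1\<close> of a fixed one, which leaves \<open>2 * (d + 1) + 1\<close> values.\<close>

lemma card_cover_words:
  assumes "\<And>s t. s \<in> U \<Longrightarrow> t \<in> U \<Longrightarrow> \<bar>s - t\<bar> \<le> real d / real d ^ k"
  shows "card {w \<in> words k. \<exists>a\<in>seqs. pre k a = w \<and> ev a \<in> U} \<le> 2 * d + 3"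
proof -
  let ?V = "{w \<in> words k. \<exists>a\<in>seqs. pre k a = w \<and> ev a \<in> U}"
  show ?thesis
  proof (cases "?V = {}")
    case False
    then obtain a0 where a0: "a0 \<in> seqs" "ev a0 \<in> U" by auto
    let ?h = "hval (pre k a0)"
    have "hval ` ?V \<subseteq> {?h - (d + 1) .. ?h + (d + 1)}"
    proof
      fix h assume "h \<in> hval ` ?V"
      then obtain a where a: "a \<in> seqs" "ev a \<in> U" "h = hval (pre k a)" by auto
      have "real d ^ k * \<bar>ev a - ev a0\<bar> \<le> real d"
        using assms[OF a(2) a0(2)] d_pos by (simp add: field_simps)
      then have "\<bar>real d ^ k * ev a - real d ^ k * ev a0\<bar> \<le> real d"
        using d_pos by (simp add: right_diff_distrib[symmetric] abs_mult)
      then have "\<bar>real h - real ?h\<bar> \<le> real d + 1"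
        using ev_split[OF a(1), of k] ev_split[OF a0(1), of k] a(3)
          ev_nonneg[OF tail_seqs[OF a(1)], of k] ev_nonneg[OF tail_seqs[OF a0(1)], of k]
          ev_le_1[OF tail_seqs[OF a(1)], of k] ev_le_1[OF tail_seqs[OF a0(1)], of k] by linarith
      then show "h \<in> {?h - (d + 1) .. ?h + (d + 1)}" by auto
    qed
    then have "card (hval ` ?V) \<le> card {?h - (d + 1) .. ?h + (d + 1)}"
      by (intro card_mono) auto
    also have "\<dots> \<le> 2 * d + 3" by simp
    finally show ?thesis using card_image[OF inj_on_subset[OF hval_inj[of k]], of ?V] by simp
  next
    case True
    then have "card ?V = 0" by (simp only: card.empty)
    then show ?thesis by linarith
  qed
qed

text \<open>The part of the tree at or below \<open>w\<close>; its mass under \<open>M\<close> will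
  be what the cover spends there.\<close>

definition cone :: "nat list \<Rightarrow> nat list set" where "cone w = {v. prefix w v}"

text \<open>The mismatch letter \<open>e n\<close> at place n, then the digits of \<open>x\<close>
  on the next \<open>\<kappa> n\<close> places. Besides separating overlapping matches, the mismatch
  makes the rational number behind the match have denominator exactly \<open>d^(n+1)\<close> when d
  is prime.\<close>

definition target :: "(nat \<Rightarrow> nat) \<Rightarrow> (nat \<Rightarrow> nat) \<Rightarrow> (nat \<Rightarrow> nat) \<Rightarrow> nat \<Rightarrow> nat list" where
  "target e x \<kappa> n = e n # map x [Suc n..<Suc n + \<kappa> n]"

lemma length_target [simp]: "length (target e x \<kappa> n) = Suc (\<kappa> n)"
  by (simp add: target_def)

lemma set_target: "x \<in> seqs \<Longrightarrow> e n \<in> E \<Longrightarrow> set (target e x \<kappa> n) \<subseteq> E"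
  by (auto simp: target_def seqs_def)

lemma nth_target: "i < Suc (\<kappa> n) \<Longrightarrow> target e x \<kappa> n ! i = (if i = 0 then e n else x (n + i))"
  by (cases i) (auto simp: target_def simp del: upt_Suc)

lemma nth_append_target:
  assumes "length u = n"
  shows "i < n \<Longrightarrow> (u @ target e x \<kappa> n) ! i = u ! i"
    "(u @ target e x \<kappa> n) ! n = e n"
    "n < i \<Longrightarrow> i < Suc n + \<kappa> n \<Longrightarrow> (u @ target e x \<kappa> n) ! i = x i"
  using assms by (auto simp: nth_append nth_target)

lemma prefix_iff_nth: "prefix w v \<longleftrightarrow> length w \<le> length v \<and> (\<forall>i<length w. v ! i = w ! i)"
proof
  assume "prefix w v"
  then show "length w \<le> length v \<and> (\<forall>i<length w. v ! i = w ! i)" by (auto simp: prefix_def nth_append)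
next
  assume R: "length w \<le> length v \<and> (\<forall>i<length w. v ! i = w ! i)"
  then have "take (length w) v = w" by (intro nth_equalityI) auto
  then show "prefix w v" by (metis take_is_prefix)
qed

lemma card_prefix:
  assumes "w \<in> words l" "l \<le> n"
  shows "real (card {u \<in> words n. prefix w u}) = real N ^ n / real N ^ l"
proof -
  have "{u \<in> words n. prefix w u} = {u \<in> words n. occ ((!) u) 0 w}"
    using assms by (auto simp: prefix_iff_nth occ_def words_def)
  then show ?thesis using card_occ[of w 0 n] assms by (simp add: words_def)
qed

text \<open>Suppose no extension works. Take a block of places \<open>n\<close>, late and minimal with a large sum of
  \<open>N^n g(n + 1 + \<kappa> n)\<close>: since \<open>N^k g k\<close> is huge there, the matches in the block (its last place aside)
  have small total probability. So for each \<open>n\<close> a definite proportion of the words of length \<open>n\<close> below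
  \<open>w\<close> avoid both \<open>W\<close> and the earlier matches. Along the match at \<open>n\<close> each of these spends at least
  \<open>g(n + 1 + \<kappa> n)\<close> of \<open>M\<close>, and these expenses are disjoint, hence exceed the mass below \<open>w\<close>.\<close>

lemma extension_step:
  fixes x e \<kappa> :: "nat \<Rightarrow> nat" and g :: "nat \<Rightarrow> real" and M :: "nat list measure"
  defines "z \<equiv> target e x \<kappa>"
  assumes x: "x \<in> seqs" and e: "\<And>n. e n \<in> E" "\<And>n. e n \<noteq> x n"
    and g_pos: "\<And>k. 0 < g k" and g_anti: "\<And>k l. k \<le> l \<Longrightarrow> g l \<le> g k"
    and phi_mono: "\<And>k l. k \<le> l \<Longrightarrow> real N ^ k * g k \<le> real N ^ l * g l"
    and phi_unbounded: "\<And>c. \<exists>k. c \<le> real N ^ k * g k"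
    and div: "\<not> summable (\<lambda>n. real N ^ n * g (Suc n + \<kappa> n))"
    and setsM: "sets M = UNIV" and M1: "\<And>v. v \<in> W \<Longrightarrow> emeasure M {v} = ennreal (g (length v))"
    and w: "w \<in> words L" and Fw: "emeasure M (cone w) < ennreal (g L)"
  shows "\<exists>n u. L \<le> n \<and> u \<in> words n \<and> prefix w u \<and>
    emeasure M (cone (u @ z n)) < ennreal (g (Suc n + \<kappa> n)) \<and>
    (\<forall>v\<in>W. prefix v (u @ z n) \<longrightarrow> L \<le> length v \<longrightarrow> length v < Suc n + \<kappa> n \<longrightarrow> False)"
proof (rule ccontr)
  assume contra: "\<not> ?thesis"
  define l where "l n = Suc n + \<kappa> n" for n
  define t where "t n = real N ^ n * g (l n)" for n
  have t_nonneg: "0 \<le> t n" for n unfolding t_def using less_imp_le[OF g_pos[of "l n"]] by simp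
  obtain F where F: "emeasure M (cone w) = ennreal F" "0 \<le> F"
    using Fw by (cases "emeasure M (cone w)") auto
  have FL: "F < g L" using Fw F by (simp add: ennreal_less_iff)
  \<comment> \<open>At most the proportion \<open>F / g L\<close> of the extensions of
    \<open>w\<close> is lost to \<open>W\<close> (see \<open>c1\<close>); \<eta> is what
    remains.\<close>
  define \<eta> where "\<eta> = 1 - F / g L"
  have eta: "0 < \<eta>" unfolding \<eta>_def using FL g_pos[of L] by simp
  \<comment> \<open>Solves \<open>\<eta> / (2 * N^L) * R = F + 1 / (2 * N^L)\<close>: once the sum
    of \<open>t\<close> reaches \<open>R\<close>, the total expense exceeds
    \<open>F\<close>.\<close>
  define R where "R = (2 * F * real N ^ L + 1) / \<eta>"
  have "0 < 2 * F * real N ^ L + 1" using F(2) by (simp add: add_nonneg_pos)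
  then have R: "0 < R" unfolding R_def using eta by simp
  obtain k0 where k0: "2 * R / \<eta> \<le> real N ^ k0 * g k0" using phi_unbounded by blast
  define n0 where "n0 = max k0 L"
  have n0: "L \<le> n0" "\<And>n. n0 \<le> n \<Longrightarrow> 2 * R / \<eta> \<le> real N ^ n * g n"
  proof -
    fix n assume "n0 \<le> n"
    then have "real N ^ k0 * g k0 \<le> real N ^ n * g n" by (intro phi_mono) (simp add: n0_def)
    then show "2 * R / \<eta> \<le> real N ^ n * g n" using k0 by linarith
  qed (simp add: n0_def)
  have "\<exists>n1. R \<le> (\<Sum>n=n0..<n1. t n)"
  proof -
    obtain m where m: "R + (\<Sum>n<n0. t n) < (\<Sum>n<m. t n)"
      using not_summable_partial_sum_gt[of t "R + (\<Sum>n<n0. t n)"] div t_nonneg unfolding t_def l_def by auto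
    have "(\<Sum>n<m. t n) \<le> (\<Sum>n\<in>{..<n0} \<union> {n0..<m}. t n)"
      by (rule sum_mono2) (use t_nonneg in auto)
    also have "\<dots> = (\<Sum>n<n0. t n) + (\<Sum>n=n0..<m. t n)"
      by (rule sum.union_disjoint) auto
    finally show ?thesis using m by (intro exI[of _ m]) linarith
  qed
  define n1 where "n1 = (LEAST n1. R \<le> (\<Sum>n=n0..<n1. t n))"
  have n1: "R \<le> (\<Sum>n=n0..<n1. t n)" unfolding n1_def by (rule LeastI_ex) fact
  have least: "(\<Sum>m=n0..<n. t m) < R" if "n < n1" for n
    using not_less_Least[of n "\<lambda>n1. R \<le> (\<Sum>n=n0..<n1. t n)"] that unfolding n1_def by (simp add: not_le)
  \<comment> \<open>From \<open>2 * R / \<eta> \<le> N^(l m) * g (l m) = N^(\<kappa> m + 1) * t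
    m\<close> the match at m has probability at most \<open>\<eta> / (2 * R) * t m\<close>, and
    minimality of \<open>n1\<close> keeps the sum of \<open>t\<close> below
    \<open>R\<close>.\<close>
  have prob: "(\<Sum>m=n0..<n. 1 / real N ^ Suc (\<kappa> m)) \<le> \<eta> / 2" if "n < n1" for n
  proof -
    have "1 / real N ^ Suc (\<kappa> m) \<le> (\<eta> / (2 * R)) * t m" if "m \<in> {n0..<n}" for m
    proof -
      have "2 * R / \<eta> \<le> real N ^ l m * g (l m)" using that by (intro n0(2)) (simp add: l_def)
      also have "\<dots> = real N ^ Suc (\<kappa> m) * t m" by (simp add: l_def t_def power_add)
      finally have "2 * R \<le> real N ^ Suc (\<kappa> m) * t m * \<eta>" by (simp only: pos_divide_le_eq[OF eta])
      then have "1 \<le> (real N ^ Suc (\<kappa> m) * t m * \<eta>) / (2 * R)" using R by (subst pos_le_divide_eq) simp_all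
      also have "\<dots> = (\<eta> / (2 * R)) * t m * real N ^ Suc (\<kappa> m)" by (simp only: divide_inverse ac_simps)
      finally show ?thesis using zero_less_power[OF N_pos, of "Suc (\<kappa> m)"] by (simp only: pos_divide_le_eq)
    qed
    then have "(\<Sum>m=n0..<n. 1 / real N ^ Suc (\<kappa> m)) \<le> (\<Sum>m=n0..<n. (\<eta> / (2 * R)) * t m)"
      by (rule sum_mono)
    also have "\<dots> = (\<eta> / (2 * R)) * (\<Sum>m=n0..<n. t m)" by (simp add: sum_distrib_left)
    also have "\<dots> \<le> (\<eta> / (2 * R)) * R" using least[OF that] eta R by (intro mult_left_mono) auto
    finally show ?thesis using R by simp
  qed
  \<comment> \<open>Only matches completed by place n are excluded here. Those still running at n
    are dealt with in \<open>disj_less\<close>, through the mismatch letter.\<close>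
  define U where "U n = {u \<in> words n. prefix w u \<and> (\<forall>v\<in>W. prefix v u \<longrightarrow> L \<le> length v \<longrightarrow> False) \<and>
    (\<forall>m\<in>{n0..<n}. l m \<le> n \<longrightarrow> \<not> occ ((!) u) m (z m))}" for n
  have finU: "finite (U n)" for n unfolding U_def using finite_words by simp
  have cardU: "(real N ^ n / real N ^ L) * (\<eta> / 2) \<le> real (card (U n))" if n: "n0 \<le> n" "n < n1" for n
  proof -
    let ?C = "{u \<in> words n. prefix w u}"
    define V where "V = {v \<in> W. v \<in> (\<Union>k\<in>{L..n}. words k) \<and> prefix w v}"
    define A where "A m = {u \<in> words n. prefix w u \<and> occ ((!) u) m (z m)}" for m
    define I where "I = {m \<in> {n0..<n}. l m \<le> n}"
    have finV: "finite V"
    proof (rule finite_subset)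
      show "V \<subseteq> (\<Union>k\<in>{L..n}. words k)" unfolding V_def by (rule subsetI) simp
      show "finite (\<Union>k\<in>{L..n}. words k)" by (intro finite_UN_I finite_words finite_atLeastAtMost)
    qed
    have sub: "?C \<subseteq> U n \<union> (\<Union>v\<in>V. {u \<in> words n. prefix v u}) \<union> (\<Union>m\<in>I. A m)"
    proof
      fix u assume u: "u \<in> ?C"
      show "u \<in> U n \<union> (\<Union>v\<in>V. {u \<in> words n. prefix v u}) \<union> (\<Union>m\<in>I. A m)"
      proof (cases "\<exists>v\<in>W. prefix v u \<and> L \<le> length v")
        case True
        then obtain v where v: "v \<in> W" "prefix v u" "L \<le> length v" by blast
        have "prefix w v" using u v(2,3) words_length[OF w] by (auto intro: prefix_length_prefix)
        moreover have "v \<in> words (length v)" "length v \<le> n"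
          using u prefix_length_le[OF v(2)] set_mono_prefix[OF v(2)] unfolding words_def by auto
        ultimately have "v \<in> V" unfolding V_def using v by auto
        then show ?thesis using u v(2) by auto
      next
        case False
        then show ?thesis using u unfolding U_def A_def I_def by auto
      qed
    qed
    \<comment> \<open>A word of length k is a prefix of the proportion \<open>1 / N^k\<close> of the
      words of length n, and by \<open>phi_mono\<close> this is at most
      \<open>g k / (N^L * g L)\<close>. The values \<open>g k\<close> add up to a mass below
      \<open>w\<close>, hence to at most \<open>F\<close>.\<close>
    have c1: "real (card (\<Union>v\<in>V. {u \<in> words n. prefix v u})) \<le> (real N ^ n / real N ^ L) * (F / g L)"
    proof -
      have "real (card (\<Union>v\<in>V. {u \<in> words n. prefix v u})) \<le> (\<Sum>v\<in>V. real (card {u \<in> words n. prefix v u}))"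
        using card_UN_le[OF finV, of "\<lambda>v. {u \<in> words n. prefix v u}"] by (simp flip: of_nat_sum)
      also have "\<dots> \<le> (\<Sum>v\<in>V. (real N ^ n / (real N ^ L * g L)) * g (length v))"
      proof (rule sum_mono)
        fix v assume "v \<in> V"
        then obtain k where k: "v \<in> words k" "L \<le> k" "k \<le> n" unfolding V_def by auto
        have "real N ^ L * g L \<le> real N ^ k * g k" by (rule phi_mono[OF k(2)])
        moreover have "0 < real N ^ k" "0 < real N ^ L * g L" using N_pos g_pos[of L] by simp_all
        ultimately have "1 / real N ^ k \<le> g k / (real N ^ L * g L)"
          by (subst pos_divide_le_eq, simp) (simp add: mult.commute[of "g k"])
        then have "real N ^ n * (1 / real N ^ k) \<le> real N ^ n * (g k / (real N ^ L * g L))"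
          by (intro mult_left_mono) auto
        then show "real (card {u \<in> words n. prefix v u}) \<le> (real N ^ n / (real N ^ L * g L)) * g (length v)"
          using card_prefix[OF k(1,3)] words_length[OF k(1)] by simp
      qed
      also have "\<dots> = (real N ^ n / (real N ^ L * g L)) * (\<Sum>v\<in>V. g (length v))" by (simp add: sum_distrib_left)
      also have "\<dots> \<le> (real N ^ n / (real N ^ L * g L)) * F"
      proof (rule mult_left_mono)
        have "ennreal (\<Sum>v\<in>V. g (length v)) = (\<Sum>v\<in>V. emeasure M {v})"
          using M1 g_pos by (simp add: V_def less_imp_le flip: sum_ennreal)
        also have "\<dots> = emeasure M V"
          by (rule emeasure_eq_sum_singleton[symmetric]) (simp_all add: finV setsM)
        also have "\<dots> \<le> emeasure M (cone w)"
          by (rule emeasure_mono) (auto simp: V_def cone_def setsM)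
        finally show "(\<Sum>v\<in>V. g (length v)) \<le> F" using F by (simp add: ennreal_le_iff)
      qed (use g_pos[of L] in simp)
      finally show ?thesis by simp
    qed
    have c2: "real (card (\<Union>m\<in>I. A m)) \<le> (real N ^ n / real N ^ L) * (\<eta> / 2)"
    proof -
      have finI: "finite I" unfolding I_def by simp
      have "real (card (\<Union>m\<in>I. A m)) \<le> (\<Sum>m\<in>I. real (card (A m)))"
        using card_UN_le[OF finI, of A] by (simp flip: of_nat_sum)
      also have "\<dots> \<le> (\<Sum>m\<in>I. (real N ^ n / real N ^ L) * (1 / real N ^ Suc (\<kappa> m)))"
      proof (rule sum_mono)
        fix m assume m: "m \<in> I"
        have "A m = {u \<in> words n. occ ((!) u) 0 w \<and> occ ((!) u) m (z m)}"
          unfolding A_def using w n n0(1) by (auto simp: prefix_iff_nth occ_def words_def)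
        moreover have "0 + length w \<le> m" "m + length (z m) \<le> n"
          using m n0(1) words_length[OF w] unfolding I_def z_def l_def by auto
        ultimately have "real (card (A m)) = real N ^ n * (1 / real N ^ length w * (1 / real N ^ length (z m)))"
          using card_occ2[of w "z m" 0 m n] w set_target[of x e m \<kappa>, OF x e(1)] unfolding z_def by (simp add: words_def)
        then show "real (card (A m)) \<le> (real N ^ n / real N ^ L) * (1 / real N ^ Suc (\<kappa> m))"
          using words_length[OF w] by (simp add: z_def)
      qed
      also have "\<dots> \<le> (\<Sum>m=n0..<n. (real N ^ n / real N ^ L) * (1 / real N ^ Suc (\<kappa> m)))"
        by (rule sum_mono2) (auto simp: I_def)
      also have "\<dots> = (real N ^ n / real N ^ L) * (\<Sum>m=n0..<n. 1 / real N ^ Suc (\<kappa> m))"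
        by (simp only: sum_distrib_left)
      also have "\<dots> \<le> (real N ^ n / real N ^ L) * (\<eta> / 2)"
        using prob[OF n(2)] by (intro mult_left_mono) auto
      finally show ?thesis .
    qed
    have "card ?C \<le> card (U n \<union> (\<Union>v\<in>V. {u \<in> words n. prefix v u}) \<union> (\<Union>m\<in>I. A m))"
      by (rule card_mono[OF _ sub]) (use finU finV finite_words in \<open>auto simp: A_def I_def\<close>)
    also have "\<dots> \<le> card (U n) + card (\<Union>v\<in>V. {u \<in> words n. prefix v u}) + card (\<Union>m\<in>I. A m)"
      by (meson card_Un_le add_right_mono order_trans)
    finally have "real (card ?C) \<le> real (card (U n)) + (real N ^ n / real N ^ L) * (F / g L)
        + (real N ^ n / real N ^ L) * (\<eta> / 2)"
      using c1 c2 by linarith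
    moreover have "real (card ?C) = (real N ^ n / real N ^ L) * (F / g L + \<eta> / 2 + \<eta> / 2)"
      using card_prefix[OF w] n n0(1) by (simp add: \<eta>_def)
    moreover have "b \<le> c" if "p \<le> c + a + b" "p = a + b + b" for a b c p :: real using that by linarith
    ultimately show ?thesis unfolding distrib_left by blast
  qed
  \<comment> \<open>The path of the match: the proper prefixes of \<open>u @ z n\<close> longer than
    n, together with everything at or below \<open>u @ z n\<close>.\<close>
  define tube where "tube = (\<lambda>(n, u). {v. n < length v \<and> (\<forall>i < min (length v) (l n). v ! i = (u @ z n) ! i)})"
  let ?P = "Sigma {n0..<n1} U"
  \<comment> \<open>If no extension works, either the cone of \<open>u @ z n\<close> is expensive,
    or a word of \<open>W\<close> lies on the path. Such a word is longer than n since
    \<open>u\<close> avoids \<open>W\<close>, and being shorter than \<open>l n\<close> it alone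
    weighs at least \<open>g (l n)\<close>.\<close>
  have tube_ge: "ennreal (g (l n)) \<le> emeasure M (tube (n, u))" if n: "n \<in> {n0..<n1}" and u: "u \<in> U n" for n u
  proof -
    have u': "u \<in> words n" "prefix w u" "L \<le> n" using u n n0(1) unfolding U_def by auto
    have len: "length (u @ z n) = l n" using words_length[OF u'(1)] by (simp add: z_def l_def)
    have "\<not> emeasure M (cone (u @ z n)) < ennreal (g (l n)) \<or>
      (\<exists>v\<in>W. prefix v (u @ z n) \<and> L \<le> length v \<and> length v < l n)"
      using contra u' unfolding l_def by blast
    then show ?thesis
    proof
      assume "\<not> emeasure M (cone (u @ z n)) < ennreal (g (l n))"
      moreover have "emeasure M (cone (u @ z n)) \<le> emeasure M (tube (n, u))"
      proof (rule emeasure_mono)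
        show "cone (u @ z n) \<subseteq> tube (n, u)"
          using len by (auto simp: cone_def tube_def prefix_iff_nth l_def)
      qed (simp add: setsM)
      ultimately show ?thesis by (simp add: not_less)
    next
      assume "\<exists>v\<in>W. prefix v (u @ z n) \<and> L \<le> length v \<and> length v < l n"
      then obtain v where v: "v \<in> W" "prefix v (u @ z n)" "L \<le> length v" "length v < l n" by blast
      have "\<not> prefix v u" using u v unfolding U_def by blast
      then have "n < length v" using v(2) words_length[OF u'(1)]
        by (metis not_le_imp_less prefix_length_prefix prefixI)
      then have "v \<in> tube (n, u)" using v(2) by (auto simp: tube_def prefix_iff_nth)
      then have "emeasure M {v} \<le> emeasure M (tube (n, u))"
        by (intro emeasure_mono) (auto simp: setsM)
      moreover have "g (l n) \<le> g (length v)" using v(4) by (intro g_anti) simp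
      ultimately show ?thesis using M1[OF v(1)] by (metis ennreal_leI order_trans)
    qed
  qed
  have tube_take: "take n v = u" if "u \<in> words n" "v \<in> tube (n, u)" for n u v
  proof (rule nth_equalityI)
    show "length (take n v) = length u" using that by (auto simp: tube_def words_def)
    fix i assume "i < length (take n v)"
    then show "take n v ! i = u ! i" using that by (auto simp: tube_def l_def words_def nth_append)
  qed
  \<comment> \<open>Let v lie in both tubes. If the run of n is complete by m, then
    \<open>u'\<close> contains a match that \<open>U m\<close> forbids; otherwise the run prescribes
    \<open>x m\<close> at place m, where the later match wants \<open>e m\<close>.\<close>
  have disj_less: "tube (n, u) \<inter> tube (m, u') = {}"
    if nm: "n < m" "n0 \<le> n" and u: "u \<in> U n" "u' \<in> U m" for n m u u'
  proof (rule ccontr)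
    assume "tube (n, u) \<inter> tube (m, u') \<noteq> {}"
    then obtain v where v: "v \<in> tube (n, u)" "v \<in> tube (m, u')" by blast
    have uw: "u \<in> words n" "u' \<in> words m" using u unfolding U_def by auto
    have len: "length u = n" "length u' = m" using uw by (auto simp: words_def)
    have mv: "m < length v" using v(2) by (auto simp: tube_def)
    show False
    proof (cases "l n \<le> m")
      case True
      have "occ ((!) u') n (z n)" unfolding occ_def
      proof (intro allI impI)
        fix i assume i: "i < length (z n)"
        then have "n + i < l n" by (simp add: z_def l_def)
        then have "u' ! (n + i) = v ! (n + i)" "v ! (n + i) = (u @ z n) ! (n + i)"
          using tube_take[OF uw(2) v(2)] True v(1) mv by (auto simp: tube_def)
        then show "u' ! (n + i) = z n ! i" using len by (simp add: nth_append)
      qed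
      moreover have "\<not> occ ((!) u') n (z n)" using u(2) nm True unfolding U_def by auto
      ultimately show False by simp
    next
      case False
      then have "v ! m = (u @ z n) ! m" using v(1) mv by (auto simp: tube_def)
      then have "v ! m = x m" using nth_append_target(3)[OF len(1), of m \<kappa> e x] nm(1) False by (simp add: z_def l_def)
      moreover have "v ! m = (u' @ z m) ! m" using v(2) mv by (auto simp: tube_def l_def)
      then have "v ! m = e m" using nth_append_target(2)[OF len(2)] by (simp add: z_def)
      ultimately show False using e(2) by simp
    qed
  qed
  have disj: "disjoint_family_on tube ?P"
    unfolding disjoint_family_on_def
  proof (intro ballI impI)
    fix p q assume p: "p \<in> ?P" and q: "q \<in> ?P" and ne: "p \<noteq> q"
    obtain n u m u' where pq: "p = (n, u)" "q = (m, u')" by (cases p, cases q)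
    have mem: "n0 \<le> n" "n0 \<le> m" "u \<in> U n" "u' \<in> U m" using p q pq by auto
    consider "n < m" | "m < n" | "n = m" by linarith
    then show "tube p \<inter> tube q = {}"
    proof cases
      case 1 then show ?thesis using disj_less mem pq by simp
    next
      case 2 then show ?thesis using disj_less[of m n u' u] mem pq by (simp add: Int_commute)
    next
      case 3
      show ?thesis
      proof (rule ccontr)
        assume "tube p \<inter> tube q \<noteq> {}"
        then obtain v where "v \<in> tube (n, u)" "v \<in> tube (n, u')" using 3 pq by auto
        then have "u = u'" using tube_take mem 3 unfolding U_def by blast
        then show False using ne pq 3 by simp
      qed
    qed
  qed
  have sub: "(\<Union>p\<in>?P. tube p) \<subseteq> cone w"
  proof
    fix v assume "v \<in> (\<Union>p\<in>?P. tube p)"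
    then obtain n u where u: "u \<in> U n" "v \<in> tube (n, u)" by auto
    then have "take n v = u" "prefix w u" using tube_take unfolding U_def by auto
    then show "v \<in> cone w" unfolding cone_def using take_is_prefix prefix_order.trans by blast
  qed
  have "(\<Sum>p\<in>?P. ennreal (g (l (fst p)))) \<le> (\<Sum>p\<in>?P. emeasure M (tube p))"
    by (rule sum_mono) (use tube_ge in auto)
  also have "\<dots> = emeasure M (\<Union>p\<in>?P. tube p)"
    by (rule sum_emeasure) (use disj finU setsM in auto)
  also have "\<dots> \<le> emeasure M (cone w)" by (rule emeasure_mono[OF sub]) (simp add: setsM)
  finally have "ennreal (\<Sum>p\<in>?P. g (l (fst p))) \<le> ennreal F"
    using F(1) g_pos by (simp add: less_imp_le flip: sum_ennreal)
  then have le: "(\<Sum>p\<in>?P. g (l (fst p))) \<le> F" using F(2) by (simp add: ennreal_le_iff)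
  have "(\<Sum>n=n0..<n1. ((real N ^ n / real N ^ L) * (\<eta> / 2)) * g (l n)) \<le> (\<Sum>n=n0..<n1. real (card (U n)) * g (l n))"
    by (rule sum_mono, rule mult_right_mono[OF cardU]) (simp_all add: less_imp_le[OF g_pos])
  also have "\<dots> = (\<Sum>n=n0..<n1. \<Sum>u\<in>U n. g (l n))" by simp
  also have "\<dots> = (\<Sum>p\<in>?P. g (l (fst p)))"
    using finU by (subst sum.Sigma) (simp_all add: split_beta)
  also note le
  finally have "(\<Sum>n=n0..<n1. ((real N ^ n / real N ^ L) * (\<eta> / 2)) * g (l n)) \<le> F" .
  moreover have "(\<Sum>n=n0..<n1. ((real N ^ n / real N ^ L) * (\<eta> / 2)) * g (l n))
    = (\<eta> / (2 * real N ^ L)) * (\<Sum>n=n0..<n1. t n)"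
    unfolding sum_distrib_left t_def by (intro sum.cong refl) (simp add: mult_ac)
  moreover have "(\<eta> / (2 * real N ^ L)) * R \<le> (\<eta> / (2 * real N ^ L)) * (\<Sum>n=n0..<n1. t n)"
    using n1 eta by (intro mult_left_mono) auto
  moreover have "(\<eta> / (2 * real N ^ L)) * R = F + 1 / (2 * real N ^ L)"
  proof -
    have "(\<eta> / (2 * real N ^ L)) * R = (2 * F * real N ^ L + 1) / (2 * real N ^ L)"
      unfolding R_def using eta by simp
    then show ?thesis using N_pos by (simp add: add_divide_distrib)
  qed
  moreover have "0 < 1 / (2 * real N ^ L)" using N_pos by simp
  ultimately show False by linarith
qed


text \<open>For positive diameter, k is least with \<open>1 / d^k \<le> diameter U\<close>:
  monotonicity of f compares the costs, and minimality keeps the diameter below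
  \<open>d / d^k\<close>. A set of diameter 0 is free, but a word never is; the slack
  \<open>h\<close> pays for it at a depth where f is below \<open>h\<close>.\<close>

lemma cover_to_words:
  assumes U: "bounded U" "diameter U \<le> 1 / real d ^ L"
    and f: "mono_on {0<..} f" "\<And>t. 0 < t \<Longrightarrow> 0 < f t" "(f \<longlongrightarrow> 0) (at_right 0)" and h: "0 < h"
  shows "\<exists>k\<ge>L. ennreal (f (1 / real d ^ k)) \<le> gauge_val f (diameter U) + ennreal h \<and>
    card {w \<in> words k. \<exists>a\<in>seqs. pre k a = w \<and> ev a \<in> U} \<le> 2 * d + 3"
proof (cases "diameter U = 0")
  case True
  have "eventually (\<lambda>t. f t < h) (at_right 0)" by (rule order_tendstoD(2)[OF f(3) h])
  then obtain b where b: "0 < b" "\<And>t. 0 < t \<Longrightarrow> t < b \<Longrightarrow> f t < h"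
    unfolding eventually_at_right_field by auto
  obtain k where k: "k \<ge> L" "1 / real d ^ k < b" using inverse_power_small[OF b(1)] by blast
  have "f (1 / real d ^ k) \<le> h" using b(2)[OF _ k(2)] d_pos by (simp add: less_imp_le)
  then have "ennreal (f (1 / real d ^ k)) \<le> gauge_val f (diameter U) + ennreal h"
    by (simp add: True gauge_val_def ennreal_leI)
  moreover have "card {w \<in> words k. \<exists>a\<in>seqs. pre k a = w \<and> ev a \<in> U} \<le> 2 * d + 3"
  proof (rule card_cover_words)
    fix s t assume "s \<in> U" "t \<in> U"
    then have "dist s t \<le> diameter U" using diameter_bounded_bound[OF U(1)] by blast
    moreover have "0 \<le> real d / real d ^ k" by simp
    ultimately show "\<bar>s - t\<bar> \<le> real d / real d ^ k" using True by (simp add: dist_real_def)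
  qed
  ultimately show ?thesis using k(1) by blast
next
  case False
  then have D: "0 < diameter U" using diameter_ge_0[OF U(1)] by simp
  define k where "k = (LEAST k. 1 / real d ^ k \<le> diameter U)"
  have "\<exists>k. 1 / real d ^ k \<le> diameter U" using inverse_power_small[OF D] less_imp_le by blast
  then have k: "1 / real d ^ k \<le> diameter U" unfolding k_def by (rule LeastI_ex)
  have kL: "L \<le> k"
  proof -
    have "1 / real d ^ k \<le> 1 / real d ^ L" using k U(2) by simp
    then have "real d ^ L \<le> real d ^ k" using d_pos by (simp add: divide_simps)
    then show ?thesis using d_gt1 by simp
  qed
  have ball: "diameter U \<le> real d / real d ^ k"
  proof (cases k)
    case 0
    have "diameter U \<le> 1" using U(2) d_gt1 by (simp add: order_trans[of _ "1 / real d ^ L"])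
    then show ?thesis using 0 d_gt1 by simp
  next
    case (Suc m)
    then have "\<not> 1 / real d ^ m \<le> diameter U" unfolding k_def by (metis lessI not_less_Least)
    then show ?thesis using Suc d_pos by simp
  qed
  have "f (1 / real d ^ k) \<le> f (diameter U)"
    using mono_onD[OF f(1), of "1 / real d ^ k" "diameter U"] k D d_pos by simp
  then have "ennreal (f (1 / real d ^ k)) \<le> gauge_val f (diameter U) + 0"
    using False by (simp add: gauge_val_def ennreal_leI)
  also have "\<dots> \<le> gauge_val f (diameter U) + ennreal h" by (intro add_left_mono) simp
  finally have "ennreal (f (1 / real d ^ k)) \<le> gauge_val f (diameter U) + ennreal h" .
  moreover have "card {w \<in> words k. \<exists>a\<in>seqs. pre k a = w \<and> ev a \<in> U} \<le> 2 * d + 3"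
  proof (rule card_cover_words)
    fix s t assume "s \<in> U" "t \<in> U"
    then have "dist s t \<le> diameter U" using diameter_bounded_bound[OF U(1)] by blast
    then show "\<bar>s - t\<bar> \<le> real d / real d ^ k" using ball by (simp add: dist_real_def)
  qed
  ultimately show ?thesis using kL by blast
qed

lemma branch_of_chain:
  fixes F :: "nat \<Rightarrow> nat list"
  assumes "\<And>j. set (F j) \<subseteq> E" "\<And>j. prefix (F j) (F (Suc j))" "\<And>j. length (F j) < length (F (Suc j))"
  obtains a where "a \<in> seqs" "\<And>j. pre (length (F j)) a = F j"
proof -
  have mono: "prefix (F j) (F k)" if "j \<le> k" for j k
    using that by (induction rule: dec_induct) (use assms(2) prefix_order.trans in \<open>auto\<close>)
  have len: "j \<le> length (F j)" for j
  proof (induction j)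
    case (Suc j) then show ?case using assms(3)[of j] by simp
  qed simp
  \<comment> \<open>\<open>F (Suc i)\<close> has length greater than i, so its letter i exists and
    never changes later.\<close>
  define a where "a i = F (Suc i) ! i" for i
  have a: "F j ! i = a i" if "i < length (F j)" for i j
  proof (cases "j \<le> Suc i")
    case True
    then show ?thesis using mono[OF True] that by (simp add: prefix_iff_nth a_def)
  next
    case False
    then have "prefix (F (Suc i)) (F j)" by (intro mono) simp
    moreover have "i < length (F (Suc i))" using len[of "Suc i"] by simp
    ultimately show ?thesis by (simp add: prefix_iff_nth a_def)
  qed
  have "a i \<in> E" for i
  proof -
    have "i < length (F (Suc i))" using len[of "Suc i"] by simp
    then have "F (Suc i) ! i \<in> set (F (Suc i))" by (rule nth_mem)
    then show ?thesis using assms(1) by (auto simp: a_def)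
  qed
  then have "a \<in> seqs" by (simp add: seqs_def)
  moreover have "pre (length (F j)) a = F j" for j
    by (rule nth_equalityI) (simp_all add: nth_pre a)
  ultimately show ?thesis using that by blast
qed

text \<open>The content at scale \<open>1 / d^L\<close> is at least \<open>N^L * g L / c\<close>,
  and these bounds are unbounded in L. A cheaper cover would leave a word of length L whose cone
  weighs less than \<open>g L\<close>. Extending it again and again, the j-th time with run lengths
  \<open>\<kappa> j\<close>, gives a point of the limsup set. The covering set that contains this
  point contributes the prefix of length \<open>K i\<close> to \<open>W\<close>, and that length
  falls into the range excluded by one of the extensions.\<close>

theorem hausdorff_limsup_infinite:
  fixes x e :: "nat \<Rightarrow> nat" and \<kappa> :: "nat \<Rightarrow> nat \<Rightarrow> nat" and f :: "real \<Rightarrow> real"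
  assumes x: "x \<in> seqs" and e: "\<And>n. e n \<in> E" "\<And>n. e n \<noteq> x n"
    and f: "mono_on {0<..} f" "\<And>t. 0 < t \<Longrightarrow> 0 < f t" "(f \<longlongrightarrow> 0) (at_right 0)"
    and phi_mono: "\<And>k l. k \<le> l \<Longrightarrow> real N ^ k * f (1 / real d ^ k) \<le> real N ^ l * f (1 / real d ^ l)"
    and phi_unbounded: "\<And>c. \<exists>k. c \<le> real N ^ k * f (1 / real d ^ k)"
    and div: "\<And>j. \<not> summable (\<lambda>n. real N ^ n * f (1 / real d ^ (Suc n + \<kappa> j n)))"
  shows "hausdorff_measure f (ev ` {a \<in> seqs. \<forall>j. \<exists>n\<ge>j. occ a n (target e x (\<kappa> j) n)}) = top"
proof -
  let ?T = "{a \<in> seqs. \<forall>j. \<exists>n\<ge>j. occ a n (target e x (\<kappa> j) n)}"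
  define g where "g k = f (1 / real d ^ k)" for k
  define c where "c = real (2 * d + 3)"
  have c: "0 < c" by (simp add: c_def)
  have g_pos: "0 < g k" for k unfolding g_def using d_pos by (intro f(2)) simp
  have g_anti: "g l \<le> g k" if "k \<le> l" for k l
    unfolding g_def using that d_gt1
    by (intro mono_onD[OF f(1)]) (auto simp: divide_simps power_increasing)
  have content: "ennreal (real N ^ L * g L / c) \<le> hausdorff_content f (1 / real d ^ L) (ev ` ?T)" for L
  proof (rule ccontr)
    assume "\<not> ?thesis"
    then have "hausdorff_content f (1 / real d ^ L) (ev ` ?T) < ennreal (real N ^ L * g L / c)" by (simp add: not_le)
    from ex_near_cover[OF this] obtain U where
      "near_cover f (1 / real d ^ L) (ev ` ?T) (ennreal (real N ^ L * g L / c)) U" ..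
    note U = near_coverD[OF this]
    obtain b where b: "(\<Sum>i. gauge_val f (diameter (U i))) = ennreal b" "0 \<le> b"
      using U(4) by (cases "\<Sum>i. gauge_val f (diameter (U i))") auto
    have bL: "b < real N ^ L * g L / c" using U(4) b by (simp add: ennreal_less_iff)
    \<comment> \<open>Half of the available gap: it pays the slacks \<open>h i\<close> of all
      covering sets and keeps \<open>c * (b + \<epsilon>)\<close> below
      \<open>N^L * g L\<close>.\<close>
    define \<epsilon> where "\<epsilon> = (real N ^ L * g L / c - b) / 2"
    have eps: "0 < \<epsilon>" using bL by (simp add: \<epsilon>_def)
    have beps: "c * (b + \<epsilon>) < real N ^ L * g L"
    proof -
      have "b + \<epsilon> < real N ^ L * g L / c" 
      proof -
        have "b + (y - b) / 2 < y" if "b < y" for y using that by (simp add: field_simps)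
        then show ?thesis using bL unfolding \<epsilon>_def by blast
      qed
      then show ?thesis using c by (simp add: pos_less_divide_eq mult.commute)
    qed
    define h where "h i = \<epsilon> * (1/2) ^ Suc i" for i :: nat
    have h_pos: "0 < h i" for i using eps by (simp add: h_def)
    have h_sums: "(\<Sum>i. ennreal (h i)) = ennreal \<epsilon>"
    proof -
      have hs: "h sums \<epsilon>" unfolding h_def using sums_mult[OF power_half_series, of \<epsilon>] by simp
      show ?thesis
        by (subst suminf_ennreal2) (use h_pos hs in \<open>auto simp: sums_iff less_imp_le\<close>)
    qed
    define V where "V i k = {w \<in> words k. \<exists>a\<in>seqs. pre k a = w \<and> ev a \<in> U i}" for i k
    have "\<forall>i. \<exists>k. L \<le> k \<and> ennreal (g k) \<le> gauge_val f (diameter (U i)) + ennreal (h i) \<and> card (V i k) \<le> 2 * d + 3"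
      using cover_to_words[OF U(2,3) f h_pos] unfolding V_def g_def by blast
    from choice[OF this] obtain K where
      K: "\<And>i. L \<le> K i" "\<And>i. ennreal (g (K i)) \<le> gauge_val f (diameter (U i)) + ennreal (h i)"
        "\<And>i. card (V i (K i)) \<le> 2 * d + 3" by blast
    define W where "W = (\<Union>i. V i (K i))"
    \<comment> \<open>A word obtained from several covering sets is weighed once, so that the
      singletons of \<open>W\<close> have mass exactly \<open>g\<close>; subadditivity still bounds
      the total by the cost of the cover.\<close>
    define M where "M = density (count_space UNIV) (\<lambda>v. if v \<in> W then ennreal (g (length v)) else 0)"
    have setsM: "sets M = UNIV" by (simp add: M_def)
    have emM: "emeasure M X = (\<integral>\<^sup>+ v. (if v \<in> W then ennreal (g (length v)) else 0) * indicator X v \<partial>count_space UNIV)" for X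
      unfolding M_def by (rule emeasure_density) auto
    have M1: "emeasure M {v} = ennreal (g (length v))" if "v \<in> W" for v
      unfolding emM using that by simp
    have M0: "emeasure M (- W) = 0"
    proof -
      have "(\<lambda>v. (if v \<in> W then ennreal (g (length v)) else 0) * indicator (- W) v) = (\<lambda>v. 0)"
        by (auto simp: fun_eq_iff)
      then show ?thesis unfolding emM by simp
    qed
    have MV: "emeasure M (V i (K i)) \<le> ennreal c * (gauge_val f (diameter (U i)) + ennreal (h i))" for i
    proof -
      have fin: "finite (V i (K i))" using finite_words by (simp add: V_def)
      have "emeasure M (V i (K i)) = (\<Sum>v\<in>V i (K i). emeasure M {v})"
        by (rule emeasure_eq_sum_singleton) (simp_all add: fin setsM)
      also have "\<dots> = (\<Sum>v\<in>V i (K i). ennreal (g (K i)))"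
      proof (rule sum.cong[OF refl])
        fix v assume v: "v \<in> V i (K i)"
        then have "v \<in> W" unfolding W_def by (rule UN_I[OF UNIV_I])
        moreover have "length v = K i" using v by (simp add: V_def words_def)
        ultimately show "emeasure M {v} = ennreal (g (K i))" using M1 by simp
      qed
      also have "\<dots> = ennreal (real (card (V i (K i)))) * ennreal (g (K i))"
        by (simp add: ennreal_of_nat_eq_real_of_nat)
      also have "\<dots> \<le> ennreal c * (gauge_val f (diameter (U i)) + ennreal (h i))"
      proof (rule mult_mono)
        have "real (card (V i (K i))) \<le> c" unfolding c_def of_nat_le_iff by (rule K(3))
        then show "ennreal (real (card (V i (K i)))) \<le> ennreal c" by (rule ennreal_leI)
      qed (simp_all add: K(2))
      finally show ?thesis .
    qed
    have MW: "emeasure M UNIV \<le> ennreal (c * (b + \<epsilon>))"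
    proof -
      have "emeasure M UNIV = emeasure M (W \<union> - W)" by simp
      also have "\<dots> \<le> emeasure M W + emeasure M (- W)" by (rule emeasure_subadditive) (simp_all add: setsM)
      also have "\<dots> = emeasure M W" using M0 by simp
      also have "\<dots> \<le> (\<Sum>i. emeasure M (V i (K i)))"
        unfolding W_def by (rule emeasure_subadditive_countably) (simp add: setsM)
      also have "\<dots> \<le> (\<Sum>i. ennreal c * (gauge_val f (diameter (U i)) + ennreal (h i)))"
        by (rule suminf_le) (simp_all add: MV)
      also have "\<dots> = ennreal c * (\<Sum>i. gauge_val f (diameter (U i)) + ennreal (h i))"
        by (rule ennreal_suminf_cmult)
      also have "(\<Sum>i. gauge_val f (diameter (U i)) + ennreal (h i)) = ennreal b + ennreal \<epsilon>"
        unfolding b(1)[symmetric] h_sums[symmetric] by (rule suminf_add[symmetric]) auto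
      also have "\<dots> = ennreal (b + \<epsilon>)" using b(2) eps by simp
      also have "ennreal c * \<dots> = ennreal (c * (b + \<epsilon>))" using b(2) eps c by (simp add: ennreal_mult)
      finally show ?thesis .
    qed
    \<comment> \<open>Pigeonhole: the cones of the \<open>N^L\<close> words of length L are
      disjoint.\<close>
    have "\<exists>w\<in>words L. emeasure M (cone w) < ennreal (g L)"
    proof (rule ccontr)
      assume "\<not> ?thesis"
      then have ge: "ennreal (g L) \<le> emeasure M (cone w)" if "w \<in> words L" for w
        using that by (auto simp: not_less)
      have "ennreal (real N ^ L * g L) = (\<Sum>w\<in>words L. ennreal (g L))"
        using g_pos[of L] by (simp add: card_words ennreal_mult ennreal_of_nat_eq_real_of_nat less_imp_le)
      also have "\<dots> \<le> (\<Sum>w\<in>words L. emeasure M (cone w))" by (rule sum_mono[OF ge])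
      also have "\<dots> = emeasure M (\<Union>w\<in>words L. cone w)"
      proof (rule sum_emeasure)
        show "disjoint_family_on cone (words L)"
          unfolding disjoint_family_on_def
        proof (intro ballI impI)
          fix v w assume "v \<in> words L" "w \<in> words L" "v \<noteq> w"
          then show "cone v \<inter> cone w = {}"
            by (auto simp: cone_def words_def prefix_def append_eq_append_conv)
        qed
      qed (simp_all add: setsM finite_words)
      also have "\<dots> \<le> emeasure M UNIV" by (rule emeasure_mono) (simp_all add: setsM)
      also note MW
      finally show False using beps b(2) eps c by (simp add: ennreal_le_iff)
    qed
    then obtain w0 where w0: "w0 \<in> words L" "emeasure M (cone w0) < ennreal (g L)" ..
    \<comment> \<open>The chain must start at length L exactly: then every
      \<open>K i \<ge> L\<close> lies between the lengths of two successive words of the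
      chain.\<close>
    define P where "P j w \<longleftrightarrow> set w \<subseteq> E \<and> emeasure M (cone w) < ennreal (g (length w)) \<and> (j = 0 \<longrightarrow> length w = L)"
      for j :: nat and w
    define Q where "Q j w w' \<longleftrightarrow> prefix w w' \<and> length w < length w' \<and>
      (\<exists>n u. length w \<le> n \<and> length u = n \<and> w' = u @ target e x (\<kappa> j) n) \<and>
      (\<forall>v\<in>W. prefix v w' \<longrightarrow> length w \<le> length v \<longrightarrow> length v < length w' \<longrightarrow> False)"
      for j :: nat and w w'
    have "\<exists>F. \<forall>j. P j (F j) \<and> Q j (F j) (F (Suc j))"
    proof (rule dependent_nat_choice)
      show "\<exists>w. P 0 w" using w0 unfolding P_def words_def by auto
    next
      fix w j assume P: "P j w"
      then have w: "w \<in> words (length w)" "emeasure M (cone w) < ennreal (g (length w))"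
        unfolding P_def words_def by auto
      have "\<exists>n u. length w \<le> n \<and> u \<in> words n \<and> prefix w u \<and>
        emeasure M (cone (u @ target e x (\<kappa> j) n)) < ennreal (g (Suc n + \<kappa> j n)) \<and>
        (\<forall>v\<in>W. prefix v (u @ target e x (\<kappa> j) n) \<longrightarrow> length w \<le> length v \<longrightarrow> length v < Suc n + \<kappa> j n \<longrightarrow> False)"
        by (rule extension_step[OF x e g_pos g_anti _ _ _ setsM M1 w])
          (use phi_mono phi_unbounded div in \<open>simp_all add: g_def\<close>)
      then obtain n u where nu: "length w \<le> n" "u \<in> words n" "prefix w u"
        "emeasure M (cone (u @ target e x (\<kappa> j) n)) < ennreal (g (Suc n + \<kappa> j n))"
        "\<forall>v\<in>W. prefix v (u @ target e x (\<kappa> j) n) \<longrightarrow> length w \<le> length v \<longrightarrow> length v < Suc n + \<kappa> j n \<longrightarrow> False"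
        by blast
      let ?w = "u @ target e x (\<kappa> j) n"
      have len: "length ?w = Suc n + \<kappa> j n" "length u = n" using words_length[OF nu(2)] by simp_all
      have "set ?w \<subseteq> E" using nu(2) set_target[of x e n "\<kappa> j", OF x e(1)] by (simp add: words_def)
      then have "P (Suc j) ?w" unfolding P_def len(1) using nu(4) by simp
      moreover have "prefix w ?w" using nu(3) by (rule prefix_order.trans) simp
      then have "Q j w ?w" unfolding Q_def len(1) using nu(1,5) len(2) by auto
      ultimately show "\<exists>w'. P (Suc j) w' \<and> Q j w w'" by blast
    qed
    then obtain F where F: "\<And>j. P j (F j)" "\<And>j. Q j (F j) (F (Suc j))" by blast
    obtain a where a: "a \<in> seqs" "\<And>j. pre (length (F j)) a = F j"
      by (rule branch_of_chain[of F]) (use F in \<open>auto simp: P_def Q_def\<close>)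
    have len: "j \<le> length (F j)" for j
    proof (induction j)
      case (Suc j) then show ?case using F(2)[of j] by (simp add: Q_def)
    qed simp
    have "\<exists>n\<ge>j. occ a n (target e x (\<kappa> j) n)" for j
    proof -
      obtain n u where nu: "length (F j) \<le> n" "length u = n" "F (Suc j) = u @ target e x (\<kappa> j) n"
        using F(2)[of j] unfolding Q_def by blast
      have "occ a n (target e x (\<kappa> j) n)"
        unfolding occ_def
      proof (intro allI impI)
        fix i assume i: "i < length (target e x (\<kappa> j) n)"
        have "a (n + i) = pre (length (F (Suc j))) a ! (n + i)"
          using i nu(2,3) by (simp add: nth_pre)
        also have "\<dots> = target e x (\<kappa> j) n ! i" using a(2)[of "Suc j"] nu(2,3) by (simp add: nth_append)
        finally show "a (n + i) = target e x (\<kappa> j) n ! i" .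
      qed
      then show ?thesis using nu(1) len[of j] order_trans by blast
    qed
    then have "ev a \<in> ev ` ?T" using a(1) by blast
    then obtain i where i: "ev a \<in> U i" using U(1) by (meson UN_E subsetD)
    define v where "v = pre (K i) a"
    have "v \<in> V i (K i)" unfolding V_def v_def using i a(1) pre_words by blast
    then have vW: "v \<in> W" unfolding W_def by (rule UN_I[OF UNIV_I])
    have lenv: "length v = K i" by (simp add: v_def)
    have F0: "length (F 0) \<le> K i" using F(1)[of 0] K(1) by (simp add: P_def)
    \<comment> \<open>The extension step that crosses the length \<open>K i\<close>.\<close>
    define j where "j = (LEAST j. K i < length (F (Suc j)))"
    have "K i < length (F (Suc (K i)))" using len[of "Suc (K i)"] by simp
    then have j1: "K i < length (F (Suc j))" unfolding j_def by (rule LeastI)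
    have j2: "length (F j) \<le> K i"
    proof (cases j)
      case (Suc m)
      then have "\<not> K i < length (F (Suc m))" unfolding j_def by (metis lessI not_less_Least)
      then show ?thesis using Suc by simp
    qed (simp add: F0)
    have pv: "prefix v (F (Suc j))"
      using j1 take_pre[of "K i" "length (F (Suc j))" a] a(2)[of "Suc j"] take_is_prefix[of "K i" "F (Suc j)"]
      by (simp add: v_def)
    have "\<forall>v\<in>W. prefix v (F (Suc j)) \<longrightarrow> length (F j) \<le> length v \<longrightarrow> length v < length (F (Suc j)) \<longrightarrow> False"
      using F(2)[of j] unfolding Q_def by (elim conjE)
    from bspec[OF this vW] show False using pv j1 j2 lenv by simp
  qed
  show ?thesis
  proof (rule ccontr)
    assume "hausdorff_measure f (ev ` ?T) \<noteq> top"
    then obtain B where B: "hausdorff_measure f (ev ` ?T) = ennreal B" "0 \<le> B"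
      by (cases "hausdorff_measure f (ev ` ?T)") auto
    obtain L where L: "c * (B + 1) \<le> real N ^ L * g L" using phi_unbounded unfolding g_def by blast
    have "ennreal (real N ^ L * g L / c) \<le> ennreal B"
      using order_trans[OF content[of L] hausdorff_content_le_measure] B(1) d_pos by simp
    then have "real N ^ L * g L / c \<le> B" using B(2) by (simp add: ennreal_le_iff)
    then have "real N ^ L * g L \<le> c * B" using c by (simp add: pos_divide_le_eq mult.commute)
    then show False using L c by (simp add: distrib_left)
  qed
qed


section \<open>The Hausdorff dimension of the digit set\<close>

lemma powr_inverse_power: "(1 / real d ^ n) powr s = (1 / (real d powr s)) ^ n"
proof -
  have "(real d ^ n) powr s = (real d powr s) ^ n"
    using d_pos by (simp add: powr_realpow[symmetric] powr_powr mult.commute)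
  then show ?thesis using d_pos by (simp add: powr_divide power_divide)
qed

lemma powr_lt_N_iff: "real d powr s < real N \<longleftrightarrow> s < delta" "real N < real d powr s \<longleftrightarrow> delta < s"
proof -
  have "real d powr delta = real N" using powr_delta[of 1] by simp
  then show "real d powr s < real N \<longleftrightarrow> s < delta" "real N < real d powr s \<longleftrightarrow> delta < s"
    using powr_less_cancel_iff[OF d_gt1] by metis+
qed

lemma hausdorff_measure_digit_set_0:
  assumes "delta < s" shows "hausdorff_measure (\<lambda>t. t powr s) (digit_set d E) = 0"
  unfolding hausdorff_measure_eq_0_iff
proof (intro allI impI)
  fix r :: real assume r: "0 < r"
  let ?f = "\<lambda>t. t powr s"
  define q where "q = real N / real d powr s"
  have q: "0 < q" "q < 1" using powr_lt_N_iff(2) assms d_pos N_pos by (auto simp: q_def)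
  have bound: "hausdorff_content ?f r (digit_set d E) \<le> 0 + ennreal \<epsilon>" if eps: "0 < \<epsilon>" for \<epsilon>
  proof -
    obtain l0 where l0: "q ^ l0 < \<epsilon>" using real_arch_pow_inv[OF eps q(2)] by blast
    obtain l where l: "l0 \<le> l" "1 / real d ^ l < r" using inverse_power_small[OF r] by blast
    have "q ^ l \<le> q ^ l0" using l(1) q by (intro power_decreasing) auto
    have "digit_set d E \<subseteq> (\<Union>w\<in>words l. cylinder l w)"
    proof
      fix y assume "y \<in> digit_set d E"
      then obtain a where "a \<in> seqs" "y = ev a" unfolding digit_set_eq by auto
      then show "y \<in> (\<Union>w\<in>words l. cylinder l w)"
        using ev_in_cylinder[of a l] pre_words[of a l] by (intro UN_I[of "pre l a"]) auto
    qed
    then have "hausdorff_content ?f r (digit_set d E) \<le> hausdorff_content ?f r (\<Union>w\<in>words l. cylinder l w)"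
      by (rule hausdorff_content_mono)
    also have "\<dots> \<le> (\<Sum>w\<in>words l. hausdorff_content ?f r (cylinder l w))"
      by (rule hausdorff_content_UN_finite) (use r finite_words in auto)
    also have "\<dots> \<le> (\<Sum>w\<in>words l. ennreal ((1 / real d ^ l) powr s))"
    proof (rule sum_mono)
      fix w
      have "hausdorff_content ?f r (cylinder l w) \<le> gauge_val ?f (diameter (cylinder l w))"
        by (rule hausdorff_content_le[OF order_refl])
          (use l r in \<open>simp_all add: diameter_cylinder\<close>, simp add: cylinder_def)
      then show "hausdorff_content ?f r (cylinder l w) \<le> ennreal ((1 / real d ^ l) powr s)"
        using d_pos by (simp add: diameter_cylinder gauge_val_def)
    qed
    also have "\<dots> = ennreal (real N ^ l * (1 / real d ^ l) powr s)"
      by (simp add: card_words ennreal_mult ennreal_of_nat_eq_real_of_nat)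
    also have "real N ^ l * (1 / real d ^ l) powr s = q ^ l"
      by (simp add: powr_inverse_power q_def power_divide)
    also have "ennreal (q ^ l) \<le> 0 + ennreal \<epsilon>" using l0 \<open>q ^ l \<le> q ^ l0\<close> by (simp add: ennreal_leI)
    finally show ?thesis .
  qed
  have "hausdorff_content ?f r (digit_set d E) \<le> 0" by (rule ennreal_le_epsilon) (rule bound)
  then show "hausdorff_content ?f r (digit_set d E) = 0" by simp
qed

text \<open>The tree theorem takes the place of a mass distribution principle. With run length 0 the
  target is the single letter \<open>c'\<close>, and the series diverges because its terms are at
  least \<open>1 / N\<close>; the limsup set so obtained is a subset of the digit set.\<close>

lemma hausdorff_measure_digit_set_top:
  assumes "0 < s" "s < delta" shows "hausdorff_measure (\<lambda>t. t powr s) (digit_set d E) = top"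
proof -
  let ?f = "\<lambda>t. t powr s"
  obtain c where c: "c \<in> E" using exists_other by blast
  obtain c' where c': "c' \<in> E" "c' \<noteq> c" using exists_other by blast
  define q where "q = real N / real d powr s"
  have q: "1 < q" using powr_lt_N_iff(1) assms d_pos by (auto simp: q_def)
  have phi: "real N ^ k * ?f (1 / real d ^ k) = q ^ k" for k
    by (simp add: powr_inverse_power q_def power_divide)
  have "hausdorff_measure ?f (ev ` {a \<in> seqs. \<forall>j. \<exists>n\<ge>j. occ a n (target (\<lambda>_. c') (\<lambda>_. c) (\<lambda>_. 0) n)}) = top"
  proof (rule hausdorff_limsup_infinite)
    show "(\<lambda>_. c) \<in> seqs" using c by (simp add: seqs_def)
    show "c' \<in> E" "c' \<noteq> c" by fact+
    show "mono_on {0<..} ?f" using assms by (intro mono_onI powr_mono2) auto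
    show "0 < t powr s" if "0 < t" for t using that by simp
    show "((\<lambda>t. t powr s) \<longlongrightarrow> 0) (at_right 0)"
    proof -
      have "((\<lambda>t. t powr s) \<longlongrightarrow> 0 powr s) (at_right 0)"
        using assms by (intro tendsto_powr2 tendsto_intros) (auto simp: eventually_at_filter)
      then show ?thesis using assms by simp
    qed
    show "real N ^ k * (1 / real d ^ k) powr s \<le> real N ^ l * (1 / real d ^ l) powr s" if "k \<le> l" for k l
      unfolding phi using that q by (intro power_increasing) auto
    show "\<exists>k. y \<le> real N ^ k * (1 / real d ^ k) powr s" for y
      unfolding phi using real_arch_pow[OF q, of y] less_imp_le by blast
    show "\<not> summable (\<lambda>n. real N ^ n * (1 / real d ^ (Suc n + 0)) powr s)"
    proof
      assume "summable (\<lambda>n. real N ^ n * (1 / real d ^ (Suc n + 0)) powr s)"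
      then have "(\<lambda>n. real N ^ n * (1 / real d ^ (Suc n + 0)) powr s) \<longlonglongrightarrow> 0" by (rule summable_LIMSEQ_zero)
      moreover have "1 / real N \<le> real N ^ n * (1 / real d ^ (Suc n + 0)) powr s" for n
      proof -
        have "1 \<le> q ^ Suc n" using q by (intro one_le_power) simp
        also have "\<dots> = real N * (real N ^ n * (1 / real d ^ (Suc n + 0)) powr s)"
          using phi[of "Suc n"] by simp
        finally show ?thesis using N_pos by (simp add: pos_divide_le_eq mult.commute)
      qed
      ultimately have "1 / real N \<le> 0" by (intro LIMSEQ_le_const) auto
      then show False using N_pos by simp
    qed
  qed
  moreover have "ev ` {a \<in> seqs. \<forall>j. \<exists>n\<ge>j. occ a n (target (\<lambda>_. c') (\<lambda>_. c) (\<lambda>_. 0) n)} \<subseteq> digit_set d E"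
    unfolding digit_set_eq by (rule image_mono) simp
  from hausdorff_measure_mono[OF this, of ?f] calculation show ?thesis by (simp only: top_unique)
qed

lemma hausdorff_dim_digit_set: "hausdorff_dim (digit_set d E) = delta"
  unfolding hausdorff_dim_def
proof (rule cInf_eq_non_empty)
  let ?A = "{s. 0 < s \<and> hausdorff_measure (\<lambda>t. t powr s) (digit_set d E) = 0}"
  have gt: "s \<in> ?A" if "delta < s" for s
    using that delta_pos hausdorff_measure_digit_set_0 by simp
  show "?A \<noteq> {}" using gt[of "delta + 1"] by auto
  show "delta \<le> s" if "s \<in> ?A" for s
  proof (rule ccontr)
    assume "\<not> delta \<le> s"
    then have "hausdorff_measure (\<lambda>t. t powr s) (digit_set d E) = top"
      using that by (intro hausdorff_measure_digit_set_top) auto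
    then show False using that by simp
  qed
  show "y \<le> delta" if "\<And>s. s \<in> ?A \<Longrightarrow> y \<le> s" for y
    by (rule dense_ge) (rule that[OF gt])
qed

section \<open>Generic digit sequences\<close>

text \<open>Multiples of \<open>p\<close>, because \<open>denominator_is_power\<close> needs places
  in one residue class modulo a period; positive multiples, so that the block can be found beyond
  any given place.\<close>

definition generic :: "(nat \<Rightarrow> nat) \<Rightarrow> bool" where
  "generic a \<longleftrightarrow> (\<forall>u p. set u \<subseteq> E \<longrightarrow> 0 < p \<longrightarrow> (\<exists>n. occ a (Suc n * p) u))"

text \<open>There are countably many pairs of a block and a period. For each, the tested multiples
  of \<open>p\<close> are thinned out so that successive blocks do not overlap; all have the same
  probability, so its series diverges.\<close>

lemma hausdorff_null_nongeneric:
  "hausdorff_measure (\<lambda>t. t powr delta) (ev ` {a \<in> seqs. \<not> generic a}) = 0"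
proof -
  let ?I = "{(u :: nat list, p :: nat). set u \<subseteq> E \<and> 0 < p}"
  define A where "A = (\<lambda>(u, p). ev ` {a \<in> seqs. \<forall>n. \<not> occ a (Suc n * p) u})"
  have "hausdorff_measure (\<lambda>t. t powr delta) (A i) = 0" if "i \<in> ?I" for i
  proof -
    obtain u p where i: "i = (u, p)" "set u \<subseteq> E" "0 < p" using \<open>i \<in> ?I\<close> by auto
    have "hausdorff_measure (\<lambda>t. t powr delta) (ev ` {a \<in> seqs. \<forall>n. \<not> occ a (Suc (n * length u) * p) u}) = 0"
    proof (rule hausdorff_null_avoid_blocks[where C = 1])
      fix n m :: nat assume "n < m"
      then have "Suc n * length u \<le> m * length u" by (intro mult_right_mono) auto
      then have "Suc (n * length u) + length u \<le> Suc (m * length u)" by simp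
      then have "(Suc (n * length u) + length u) * p \<le> Suc (m * length u) * p" by (rule mult_right_mono) simp
      moreover have "length u * 1 \<le> length u * p" using i(3) by (intro mult_left_mono) auto
      ultimately show "Suc (n * length u) * p + length u \<le> Suc (m * length u) * p \<or>
        (\<forall>a. \<not> (occ a (Suc (n * length u) * p) u \<and> occ a (Suc (m * length u) * p) u))"
        unfolding distrib_right by linarith
    qed (use i N_pos in \<open>simp_all add: summable_const_iff\<close>)
    moreover have "A i \<subseteq> ev ` {a \<in> seqs. \<forall>n. \<not> occ a (Suc (n * length u) * p) u}"
      unfolding A_def i(1) prod.case by (rule image_mono) blast
    ultimately show ?thesis using hausdorff_measure_0_mono by blast
  qed
  then have "hausdorff_measure (\<lambda>t. t powr delta) (\<Union>i\<in>?I. A i) = 0"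
    by (intro hausdorff_measure_0_UN_countable) auto
  moreover have "ev ` {a \<in> seqs. \<not> generic a} \<subseteq> (\<Union>i\<in>?I. A i)"
  proof
    fix y assume "y \<in> ev ` {a \<in> seqs. \<not> generic a}"
    then obtain a u p where a: "a \<in> seqs" "y = ev a" "set u \<subseteq> E" "0 < p" "\<forall>n. \<not> occ a (Suc n * p) u"
      unfolding generic_def by blast
    then have "y \<in> A (u, p)" unfolding A_def by auto
    then show "y \<in> (\<Union>i\<in>?I. A i)" by (rule UN_I[rotated]) (use a in simp)
  qed
  ultimately show ?thesis using hausdorff_measure_0_mono by blast
qed

section \<open>Rational points of the translate: carries and denominators\<close>

lemma hval_pre_less: "a \<in> seqs \<Longrightarrow> hval (pre k a) < d ^ k"
proof (induction k)
  case 0 then show ?case by (simp add: pre_def)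
next
  case (Suc k)
  have "hval (pre (Suc k) a) < d * hval (pre k a) + d" using seqs_less[OF Suc.prems, of k] by (simp add: pre_Suc)
  also have "\<dots> = d * Suc (hval (pre k a))" by simp
  also have "\<dots> \<le> d * d ^ k" using Suc by (intro mult_left_mono Suc_leI) auto
  finally show ?case by simp
qed

lemma ev_pos:
  assumes "a \<in> seqs" "0 < a i" shows "0 < ev a"
proof -
  have "0 < real (hval (pre (Suc i) a)) / real d ^ Suc i"
    using assms(2) d_pos by (intro divide_pos_pos zero_less_power) (simp_all add: pre_Suc add_nonneg_pos)
  then show ?thesis using ev_bounds(1)[OF assms(1), of "Suc i"] by linarith
qed

lemma ev_less_1:
  assumes "a \<in> seqs" "a i = 0" shows "ev a < 1"
proof -
  have "hval (pre (Suc i) a) + 1 < d * (hval (pre i a) + 1)"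
    using assms(2) d_ge by (simp add: pre_Suc)
  also have "\<dots> \<le> d * d ^ i" using hval_pre_less[OF assms(1), of i] by (intro mult_left_mono) auto
  finally have "real (hval (pre (Suc i) a) + 1) < real (d ^ Suc i)" unfolding of_nat_less_iff by simp
  then have "(real (hval (pre (Suc i) a)) + 1) / real d ^ Suc i < 1" using d_pos by simp
  then show ?thesis using ev_bounds(2)[OF assms(1), of "Suc i"] by linarith
qed

lemma ev_zeros: "ev (\<lambda>_. 0) = 0"
  by (simp add: ev_def)

lemma ev_top: "ev (\<lambda>_. d - 1) = 1"
proof -
  have "real (d - 1) = real d - 1" using d_ge by simp
  then show ?thesis unfolding ev_def using geometric_digits by (simp add: sums_iff)
qed

lemma generic_tail:
  assumes "generic x" "x \<in> seqs" "0 \<in> E" "d - 1 \<in> E"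
  shows "0 < ev (tail n x)" "ev (tail n x) < 1"
proof -
  obtain k where k: "occ x (Suc k * Suc n) [d - 1]"
    using assms(1,4) unfolding generic_def by (metis empty_set empty_subsetI insert_subset list.simps(15) zero_less_Suc)
  have "tail n x (Suc k * Suc n - n) = d - 1" using k by (simp add: occ_def tail_def ac_simps)
  then have "0 < tail n x (Suc k * Suc n - n)" using d_ge by simp
  then show "0 < ev (tail n x)" by (rule ev_pos[OF tail_seqs[OF assms(2)]])
  obtain k' where k': "occ x (Suc k' * Suc n) [0]"
    using assms(1,3) unfolding generic_def by (metis empty_set empty_subsetI insert_subset list.simps(15) zero_less_Suc)
  have "tail n x (Suc k' * Suc n - n) = 0" using k' by (simp add: occ_def tail_def ac_simps)
  then show "ev (tail n x) < 1" by (rule ev_less_1[OF tail_seqs[OF assms(2)]])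
qed

text \<open>The two tails differ by an integer. Genericity puts the tail of \<open>x\<close>
  strictly between 0 and 1, while that of \<open>b\<close> is in [0,1], so this integer is
  0.\<close>

lemma tails_agree:
  assumes "generic x" "x \<in> seqs" "0 \<in> E" "d - 1 \<in> E" "b \<in> seqs"
    and eq: "ev b - ev x = real_of_int p / real d ^ n"
  shows "ev (tail n b) = ev (tail n x)"
proof -
  let ?h = "p - (int (hval (pre n b)) - int (hval (pre n x)))"
  have "real d ^ n * (ev b - ev x) = real_of_int p" unfolding eq using d_pos by simp
  then have "ev (tail n b) - ev (tail n x) = real_of_int ?h"
    using ev_split[OF assms(5), of n] ev_split[OF assms(2), of n] by (simp add: right_diff_distrib)
  moreover have "\<bar>ev (tail n b) - ev (tail n x)\<bar> < 1"
    using generic_tail[OF assms(1-4), of n] ev_nonneg[OF tail_seqs[OF assms(5)], of n]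
      ev_le_1[OF tail_seqs[OF assms(5)], of n] by (simp add: abs_if)
  ultimately have "\<bar>real_of_int ?h\<bar> < 1" by simp
  then have "?h = 0" by linarith
  then show ?thesis using \<open>ev (tail n b) - ev (tail n x) = real_of_int ?h\<close> by simp
qed

text \<open>Since d is prime, the orbit of one digit under the nontrivial rotation by
  \<open>D\<close> has d elements.\<close>

lemma card_ge_of_shift_invariant:
  fixes D :: int
  assumes "prime d" "\<not> int d dvd D" "\<And>e. e \<in> E \<Longrightarrow> nat ((int e + D) mod int d) \<in> E"
  shows "d \<le> card E"
proof -
  have dp: "0 < int d" using d_ge by simp
  obtain e where e: "e \<in> E" using exists_other by blast
  define h where "h k = nat ((int e + int k * D) mod int d)" for k :: nat
  have "h k \<in> E" for k
  proof (induction k)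
    case 0
    have "e < d" using e E_less by auto
    then show ?case using e by (simp add: h_def)
  next
    case (Suc k)
    have "int (h k) = (int e + int k * D) mod int d" using dp by (simp add: h_def)
    then have "(int (h k) + D) mod int d = (int e + int k * D + D) mod int d" by (simp only: mod_add_left_eq)
    also have "int e + int k * D + D = int e + int (Suc k) * D" by (simp add: algebra_simps)
    finally have "nat ((int (h k) + D) mod int d) = h (Suc k)" by (simp only: h_def)
    then show ?case using assms(3)[OF Suc] by simp
  qed
  moreover have "inj_on h {..<d}"
  proof (rule inj_onI)
    fix k k' assume k: "k \<in> {..<d}" "k' \<in> {..<d}" "h k = h k'"
    then have "(int e + int k * D) mod int d = (int e + int k' * D) mod int d"
      using dp by (simp add: h_def eq_nat_nat_iff)
    then have "int d dvd (int e + int k * D) - (int e + int k' * D)" by (simp add: mod_eq_dvd_iff)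
    then have "int d dvd (int k - int k') * D" by (simp add: algebra_simps)
    then have "int d dvd int k - int k'"
      using assms(1,2) prime_dvd_mult_iff[of "int d" "int k - int k'" D] by simp
    then have "\<not> 0 < \<bar>int k - int k'\<bar> \<or> int d \<le> \<bar>int k - int k'\<bar>"
      using zdvd_imp_le[of "int d" "\<bar>int k - int k'\<bar>"] by auto
    then show "k = k'" using k(1,2) by auto
  qed
  ultimately have "card {..<d} \<le> card E" by (intro card_inj_on_le[of h]) (auto simp: finite_E)
  then show ?thesis by simp
qed

text \<open>The powers of d are eventually periodic modulo q; \<open>K\<close> is a multiple of the
  period that is not smaller than the preperiod \<open>i\<close>. This covers q sharing factors with
  d.\<close>

lemma power_mod_stable:
  assumes "0 < q" shows "\<exists>K>0. \<forall>j. d ^ (Suc j * K) mod q = d ^ K mod q"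
proof -
  have "\<not> inj_on (\<lambda>n. d ^ n mod q) (UNIV :: nat set)"
  proof
    assume "inj_on (\<lambda>n. d ^ n mod q) (UNIV :: nat set)"
    moreover have "finite (range (\<lambda>n. d ^ n mod q))"
      by (rule finite_subset[of _ "{..<q}"]) (use assms in auto)
    ultimately show False using finite_imageD infinite_UNIV_nat by blast
  qed
  then obtain i j where "i < j" "d ^ i mod q = d ^ j mod q"
    unfolding inj_on_def by (auto elim!: linorder_neqE_nat)
  define p where "p = j - i"
  have p: "0 < p" "d ^ (i + p) mod q = d ^ i mod q" using \<open>i < j\<close> \<open>d ^ i mod q = d ^ j mod q\<close> by (simp_all add: p_def)
  have step: "d ^ (n + p) mod q = d ^ n mod q" if "i \<le> n" for n
  proof -
    have "d ^ (n + p) mod q = (d ^ (i + p) * d ^ (n - i)) mod q" using that by (simp add: ac_simps flip: power_add)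
    also have "\<dots> = (d ^ i * d ^ (n - i)) mod q" using p(2) by (metis mod_mult_left_eq)
    finally show ?thesis using that by (simp flip: power_add)
  qed
  have steps: "d ^ (n + k * p) mod q = d ^ n mod q" if "i \<le> n" for n k
  proof (induction k)
    case (Suc k)
    have "d ^ (n + Suc k * p) mod q = d ^ ((n + k * p) + p) mod q" by (simp add: algebra_simps)
    then show ?case using step[of "n + k * p"] that Suc by simp
  qed simp
  define K where "K = Suc i * p"
  have K: "0 < K" using p(1) by (simp add: K_def)
  have "Suc i * 1 \<le> Suc i * p" using p(1) by (intro mult_left_mono) auto
  then have iK: "i \<le> K" by (simp add: K_def)
  have "d ^ (Suc k * K) mod q = d ^ K mod q" for k
  proof -
    have "Suc k * K = K + (k * Suc i) * p" unfolding K_def by (simp only: mult_Suc mult.assoc)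
    then show ?thesis using steps[OF iK, of "k * Suc i"] by simp
  qed
  then show ?thesis using K by blast
qed


text \<open>Where \<open>x\<close> reads a digit \<open>c\<close> followed by a long run of zeros (or of digits \<open>d - 1\<close>), the carry in
  \<open>x + p/q\<close> is forced to be 0 (or 1). Choosing such places in the same residue class modulo the period
  of the expansion of \<open>p/q\<close>, the digits of \<open>x + p/q\<close> there are \<open>c + D\<close> (or \<open>c + D + 1\<close>) modulo \<open>d\<close>
  with a fixed \<open>D\<close>; so \<open>E\<close> would be invariant under a nontrivial rotation of the integers modulo the
  prime \<open>d\<close>.\<close>

lemma denominator_is_power:
  assumes d: "prime d" and cE: "card E < d" and zero: "0 \<in> E" and top: "d - 1 \<in> E"
    and x: "x \<in> seqs" "generic x" and b: "b \<in> seqs"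
    and q: "0 < q" "coprime p (int q)" and eq: "ev b - ev x = real_of_int p / real q"
  shows "\<exists>n. q = d ^ n"
proof (rule ccontr)
  assume contra: "\<not> ?thesis"
  have nd: "\<not> q dvd d ^ n" for n
    using contra divides_primepow_nat[OF d, of q n] by blast
  \<comment> \<open>By \<open>T_real\<close> this is q times the difference of the tails at place n:
    an integer between -q and q whose residue is that of \<open>d^n * p\<close>, hence determined up
    to a carry.\<close>
  define T where "T n = int d ^ n * p - int q * (int (hval (pre n b)) - int (hval (pre n x)))" for n
  have T_real: "real_of_int (T n) = real q * (ev (tail n b) - ev (tail n x))" for n
  proof -
    have p: "real_of_int p = real q * (ev b - ev x)" using eq q(1) by simp
    have "real_of_int (T n) = real d ^ n * real_of_int p - real q * (real (hval (pre n b)) - real (hval (pre n x)))"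
      by (simp add: T_def)
    also have "\<dots> = real q * (real d ^ n * ev b - real d ^ n * ev x
      - (real (hval (pre n b)) - real (hval (pre n x))))"
      unfolding p by (simp add: algebra_simps)
    finally show ?thesis using ev_split[OF b, of n] ev_split[OF x(1), of n] by simp
  qed
  have T_mod: "T n mod int q = (int (d ^ n mod q) * p) mod int q" for n
  proof -
    have "T n mod int q = (int d ^ n * p) mod int q" unfolding T_def by (simp add: mod_diff_eq[symmetric])
    also have "\<dots> = ((int d ^ n mod int q) * p) mod int q" by (simp add: mod_mult_left_eq)
    finally show ?thesis by (simp add: zmod_int)
  qed
  have T_nd: "\<not> int q dvd T n" for n
  proof
    assume "int q dvd T n"
    then have "int q dvd T n + int q * (int (hval (pre n b)) - int (hval (pre n x)))" by simp
    then have "int q dvd int d ^ n * p" by (simp add: T_def)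
    then have "int q dvd int d ^ n" using q(2) by (simp add: coprime_dvd_mult_left_iff coprime_commute)
    then show False using nd[of n] by (simp flip: of_nat_power)
  qed
  have T_Suc: "T (Suc n) = int d * T n - int q * (int (b n) - int (x n))" for n
    by (simp add: T_def pre_Suc algebra_simps)
  \<comment> \<open>At positive multiples of \<open>K\<close>, \<open>T\<close> has the fixed
    residue \<open>R0\<close>, and one place later the residue \<open>R1\<close>.\<close>
  obtain K where K: "0 < K" "\<And>j. d ^ (Suc j * K) mod q = d ^ K mod q" using power_mod_stable[OF q(1)] by blast
  define R0 where "R0 = T K mod int q"
  define R1 where "R1 = T (Suc K) mod int q"
  have R0: "T (Suc j * K) mod int q = R0" for j
    unfolding R0_def T_mod K(2) ..
  have R1: "T (Suc (Suc j * K)) mod int q = R1" for j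
  proof -
    have "d ^ Suc (Suc j * K) mod q = (d * (d ^ (Suc j * K) mod q)) mod q" by (simp add: mod_mult_right_eq)
    also have "\<dots> = d ^ Suc K mod q" unfolding K(2) by (simp add: mod_mult_right_eq)
    finally show ?thesis unfolding R1_def T_mod by simp
  qed
  have qd: "real q < real d ^ q"
    using power_gt_expt[of d q] d_ge by (simp flip: of_nat_power)
  \<comment> \<open>Solving \<open>T_Suc\<close> for the digit gives
    \<open>b n = c + d * s + r + (d * R0 - R1) / q\<close>, that is, \<open>c + D + r\<close> modulo
    d. The carry is \<open>r\<close>, and \<open>D\<close> does not depend on the chosen multiple of
    \<open>K\<close>.\<close>
  define D where "D = (int d * R0 - R1) div int q"
  have rotate: "int q * (int (b n) - int c - int d * s - r) = int d * R0 - R1"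
    if "x n = c" "T n = R0 + int q * s" "T (Suc n) = R1 - int q * r" for n c s r
    using T_Suc[of n] that by (simp add: algebra_simps)
  have main: "nat ((int c + (D + r)) mod int d) \<in> E"
    if c: "c \<in> E" and run: "k \<in> E"
      and carry: "\<And>n. (\<And>i. i < q \<Longrightarrow> tail (Suc n) x i = k) \<Longrightarrow> T (Suc n) = T (Suc n) mod int q - int q * r"
    for c k r
  proof -
    have "set (c # replicate q k) \<subseteq> E" using c run by (auto simp: set_replicate_conv_if)
    then obtain j where j: "occ x (Suc j * K) (c # replicate q k)"
      using x(2) K(1) unfolding generic_def by blast
    define n where "n = Suc j * K"
    have xn: "x n = c" using j unfolding n_def occ_def by (auto dest: spec[of _ 0])
    have "tail (Suc n) x i = k" if "i < q" for i
      using j that unfolding n_def[symmetric] occ_def by (auto simp: tail_def add.commute dest!: spec[of _ "Suc i"])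
    then have T1: "T (Suc n) = R1 - int q * r" using carry[of n] R1[of j] by (simp add: n_def)
    have T0: "T n = R0 + int q * (T n div int q)" using R0[of j] mult_div_mod_eq[of "int q" "T n"] unfolding n_def by simp
    have "int d * R0 - R1 = int q * (int (b n) - int c - int d * (T n div int q) - r)"
      by (rule rotate[OF xn T0 T1, symmetric])
    then have "D = int (b n) - int c - int d * (T n div int q) - r" unfolding D_def using q(1) by simp
    then have "int c + (D + r) = int (b n) + int d * (- (T n div int q))" by simp
    then have "(int c + (D + r)) mod int d = int (b n) mod int d" by (simp only: mod_mult_self2)
    also have "\<dots> = int (b n)" using seqs_less[OF b, of n] by simp
    finally show ?thesis using seqs_mem[OF b, of n] by simp
  qed
  \<comment> \<open>Why runs of length q suffice: as \<open>q < d^q\<close>, the tail of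
    \<open>x\<close> then differs from the constant expansion by less than
    \<open>1 / q\<close>.\<close>
  have small: "real q * (1 / real d ^ q) < 1" using qd d_pos by (simp add: divide_simps)
  have close: "real q * \<bar>ev (tail n x) - ev (\<lambda>_. k)\<bar> < 1"
    if "k \<in> E" "\<And>i. i < q \<Longrightarrow> tail n x i = k" for n k
  proof -
    have "\<bar>ev (tail n x) - ev (\<lambda>_. k)\<bar> \<le> 1 / real d ^ q"
      by (rule ev_dist) (use that x tail_seqs in \<open>auto simp: seqs_def\<close>)
    then have "real q * \<bar>ev (tail n x) - ev (\<lambda>_. k)\<bar> \<le> real q * (1 / real d ^ q)" by (intro mult_left_mono) auto
    then show ?thesis using small by linarith
  qed
  have bounds: "0 \<le> real q * ev (tail n b)" "real q * ev (tail n b) \<le> real q" for n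
    using ev_nonneg[OF tail_seqs[OF b]] ev_le_1[OF tail_seqs[OF b]] by (simp_all add: mult_left_le)
  have bounds_x: "0 \<le> real q * ev (tail n x)" "real q * ev (tail n x) \<le> real q" for n
    using ev_nonneg[OF tail_seqs[OF x(1)]] ev_le_1[OF tail_seqs[OF x(1)]] by (simp_all add: mult_left_le)
  have T_ne: "T n \<noteq> 0" "T n \<noteq> int q" "T n \<noteq> - int q" for n using T_nd[of n] by auto
  \<comment> \<open>An integer above -1, at most q and not divisible by q equals its residue. In
    \<open>carry1\<close> the value lies strictly between -q and 0 instead.\<close>
  have carry0: "T (Suc n) = T (Suc n) mod int q - int q * 0" if "\<And>i. i < q \<Longrightarrow> tail (Suc n) x i = 0" for n
  proof -
    have "real q * ev (tail (Suc n) x) < 1"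
      using close[OF zero that] ev_nonneg[OF tail_seqs[OF x(1)], of "Suc n"] by (simp add: ev_zeros)
    then have "real_of_int (T (Suc n)) > -1" "real_of_int (T (Suc n)) \<le> real q"
      unfolding T_real right_diff_distrib using bounds[of "Suc n"] bounds_x[of "Suc n"] by linarith+
    then have "0 \<le> T (Suc n)" "T (Suc n) \<le> int q" by linarith+
    then show ?thesis using T_ne[of "Suc n"] by simp
  qed
  have carry1: "T (Suc n) = T (Suc n) mod int q - int q * 1" if "\<And>i. i < q \<Longrightarrow> tail (Suc n) x i = d - 1" for n
  proof -
    have "real q * (1 - ev (tail (Suc n) x)) < 1"
      using close[OF top that, unfolded ev_top] ev_le_1[OF tail_seqs[OF x(1)], of "Suc n"] by simp
    then have "real_of_int (T (Suc n)) < 1" "real_of_int (T (Suc n)) \<ge> - real q"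
      unfolding T_real right_diff_distrib using bounds[of "Suc n"] bounds_x[of "Suc n"] by linarith+
    then have "T (Suc n) \<le> 0" "- int q \<le> T (Suc n)" by linarith+
    then have "(T (Suc n) + int q) mod int q = T (Suc n) + int q"
      using T_ne[of "Suc n"] by (intro mod_pos_pos_trivial) linarith+
    then show ?thesis by simp
  qed
  have rot0: "nat ((int c + (D + 0)) mod int d) \<in> E" if "c \<in> E" for c
    by (rule main[OF that zero]) (rule carry0)
  have rot1: "nat ((int c + (D + 1)) mod int d) \<in> E" if "c \<in> E" for c
    by (rule main[OF that top]) (rule carry1)
  have "\<not> int d dvd D + 0 \<or> \<not> int d dvd D + 1"
  proof (rule ccontr)
    assume "\<not> ?thesis"
    then have "int d dvd (D + 1) - D" by (intro dvd_diff) auto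
    then show False using d_ge by simp
  qed
  then show False
    using card_ge_of_shift_invariant[OF d _ rot0] card_ge_of_shift_invariant[OF d _ rot1] cE by linarith
qed

text \<open>The rational is \<open>ev b - ev x\<close>, where \<open>b\<close> has the digits of
  \<open>a\<close> up to place n and those of \<open>x\<close> afterwards. Modulo d its numerator is
  \<open>a n - x n = e n - x n\<close>, a nonzero difference of digits, so the fraction is
  reduced.\<close>

lemma intrinsic_rational_of_occ:
  assumes d: "prime d" and x: "x \<in> seqs" and a: "a \<in> seqs" and ne: "e n \<noteq> x n"
    and occ: "occ a n (target e x \<kappa> n)"
  shows "\<exists>p::int. coprime p (int (d ^ Suc n)) \<and> real_of_int p / real (d ^ Suc n) \<in> translate_set (digit_set d E) (ev x) \<and>
    \<bar>(ev a - ev x) - real_of_int p / real (d ^ Suc n)\<bar> \<le> 1 / real d ^ (Suc n + \<kappa> n)"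
proof -
  have a_n: "a n = e n"
    using occ nth_target[of 0 \<kappa> n e x] unfolding occ_def by (auto dest!: spec[of _ 0])
  have a_x: "a i = x i" if "n < i" "i < Suc n + \<kappa> n" for i
    using occ nth_target[of "i - n" \<kappa> n e x] that unfolding occ_def by (auto dest!: spec[of _ "i - n"])
  define b where "b i = (if i \<le> n then a i else x i)" for i
  have b: "b \<in> seqs" using a x by (simp add: seqs_def b_def)
  have pre_b: "pre (Suc n) b = pre (Suc n) a" by (simp add: pre_def b_def)
  have tail_b: "tail (Suc n) b = tail (Suc n) x" by (simp add: tail_def b_def)
  define p where "p = int (hval (pre (Suc n) a)) - int (hval (pre (Suc n) x))"
  have eq: "ev b - ev x = real_of_int p / real (d ^ Suc n)"
    using ev_eq[OF b, of "Suc n"] ev_eq[OF x, of "Suc n"] pre_b tail_b by (simp add: p_def diff_divide_distrib)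
  have "\<not> int d dvd p"
  proof
    assume "int d dvd p"
    moreover have "p = int d * (int (hval (pre n a)) - int (hval (pre n x))) + (int (a n) - int (x n))"
      by (simp add: p_def pre_Suc algebra_simps)
    ultimately have "int d dvd int (a n) - int (x n)" by (simp add: dvd_add_right_iff)
    then have "\<not> 0 < \<bar>int (a n) - int (x n)\<bar> \<or> int d \<le> \<bar>int (a n) - int (x n)\<bar>"
      using zdvd_imp_le[of "int d" "\<bar>int (a n) - int (x n)\<bar>"] by auto
    then show False using ne a_n seqs_less[OF a, of n] seqs_less[OF x, of n] by auto
  qed
  then have "coprime (int d) p" using d by (intro prime_imp_coprime) simp_all
  then have "coprime p (int (d ^ Suc n))" by (simp add: coprime_commute)
  moreover have "real_of_int p / real (d ^ Suc n) \<in> translate_set (digit_set d E) (ev x)"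
    unfolding eq[symmetric] translate_set_def digit_set_eq using b by blast
  moreover have "\<bar>ev a - ev b\<bar> \<le> 1 / real d ^ (Suc n + \<kappa> n)"
    by (rule ev_dist[OF a b]) (simp add: b_def a_x)
  then have "\<bar>(ev a - ev x) - real_of_int p / real (d ^ Suc n)\<bar> \<le> 1 / real d ^ (Suc n + \<kappa> n)"
    unfolding eq[symmetric] by simp
  ultimately show ?thesis by blast
qed


section \<open>Well approximable points: convergence, divergence, and the dichotomy\<close>

text \<open>Any index \<open>j' \<ge> j\<close> is allowed in \<open>hits\<close>, so that the lemma
  serves both divergence cases: in one each accuracy is met infinitely often, in the other accuracy
  and place grow together. Infinitely many rationals arise because the denominators are
  unbounded.\<close>

lemma WA_int_memI:
  fixes \<kappa> :: "nat \<Rightarrow> nat \<Rightarrow> nat"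
  assumes d: "prime d" and x: "x \<in> seqs" and a: "a \<in> seqs" and ne: "\<And>n. e n \<noteq> x n"
    and psi: "\<And>n. 0 < \<psi> n"
    and \<kappa>: "\<And>j n. 1 / real d ^ \<kappa> j n \<le> \<psi> (d ^ Suc n) / real (Suc j)"
    and hits: "\<And>j m. \<exists>n\<ge>m. \<exists>j'\<ge>j. occ a n (target e x (\<kappa> j') n)"
  shows "ev a - ev x \<in> WA_int (translate_set (digit_set d E) (ev x)) \<psi>"
proof -
  let ?S = "translate_set (digit_set d E) (ev x)"
  have "intr_approx ?S (\<lambda>q. \<epsilon> * \<psi> q) (ev a - ev x)" if eps: "0 < \<epsilon>" for \<epsilon>
    unfolding intr_approx_def
  proof
    let ?Z = "{(p :: int, q :: nat). 0 < q \<and> coprime p (int q) \<and> real_of_int p / real q \<in> ?S \<and>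
        \<bar>(ev a - ev x) - real_of_int p / real q\<bar> \<le> \<epsilon> * \<psi> q / real q}"
    assume "finite ?Z"
    then have "finite (snd ` ?Z)" by (rule finite_imageI)
    then obtain B where B: "\<And>q. q \<in> snd ` ?Z \<Longrightarrow> q \<le> B" unfolding finite_nat_set_iff_bounded_le by blast
    obtain j where j: "inverse (real (Suc j)) < \<epsilon>" using reals_Archimedean[OF eps] by blast
    obtain n j' where n: "B \<le> n" "j \<le> j'" "occ a n (target e x (\<kappa> j') n)" using hits by blast
    obtain p :: int where p: "coprime p (int (d ^ Suc n))" "real_of_int p / real (d ^ Suc n) \<in> ?S"
      "\<bar>(ev a - ev x) - real_of_int p / real (d ^ Suc n)\<bar> \<le> 1 / real d ^ (Suc n + \<kappa> j' n)"
      using intrinsic_rational_of_occ[OF d x a ne n(3)] by blast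
    have "1 / real d ^ (Suc n + \<kappa> j' n) = (1 / real d ^ \<kappa> j' n) / real (d ^ Suc n)"
      by (simp add: power_add)
    also have "\<dots> \<le> (\<epsilon> * \<psi> (d ^ Suc n)) / real (d ^ Suc n)"
    proof (rule divide_right_mono)
      have "1 / real (Suc j') \<le> 1 / real (Suc j)" using n(2) by (intro divide_left_mono) auto
      then have "1 / real (Suc j') \<le> \<epsilon>" using j by (simp add: inverse_eq_divide)
      then have "1 / real (Suc j') * \<psi> (d ^ Suc n) \<le> \<epsilon> * \<psi> (d ^ Suc n)"
        using psi[of "d ^ Suc n"] by (intro mult_right_mono) auto
      then show "1 / real d ^ \<kappa> j' n \<le> \<epsilon> * \<psi> (d ^ Suc n)" using \<kappa>[of j' n] by simp
    qed simp
    finally have "(p, d ^ Suc n) \<in> ?Z" using p d_ge by auto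
    then have "snd (p, d ^ Suc n) \<in> snd ` ?Z" by (rule imageI)
    then have "d ^ Suc n \<le> B" using B by simp
    moreover have "Suc n < d ^ Suc n" using power_gt_expt[of d "Suc n"] d_ge by simp
    ultimately show False using n(1) by linarith
  qed
  moreover have "ev a - ev x \<in> ?S" unfolding translate_set_def digit_set_eq using a by blast
  ultimately show ?thesis unfolding WA_int_def badly_intr_approx_def by blast
qed

text \<open>The digits \<open>w\<close> followed by those of \<open>x\<close> from place n on,
  shifted by \<open>x\<close>: the candidates for intrinsic rationals with denominator
  \<open>d^n\<close>.\<close>

definition centre :: "(nat \<Rightarrow> nat) \<Rightarrow> nat \<Rightarrow> nat list \<Rightarrow> real" where
  "centre x n w = (real (hval w) + ev (tail n x)) / real d ^ n - ev x"

text \<open>Well approximability is used with \<epsilon> equal to 1/2 only. The resulting intervals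
  have diameter \<open>\<psi> (d^n) / d^n\<close>, the very argument of f in the series, so f needs
  no doubling property.\<close>

lemma WA_int_cover:
  assumes d: "prime d" and cE: "card E < d" and zero: "0 \<in> E" and top: "d - 1 \<in> E"
    and x: "x \<in> seqs" "generic x" and y: "y \<in> WA_int (translate_set (digit_set d E) (ev x)) \<psi>"
  shows "\<exists>n\<ge>m. \<exists>w\<in>words n. \<bar>y - centre x n w\<bar> \<le> \<psi> (d ^ n) / real (d ^ n) / 2"
proof -
  let ?S = "translate_set (digit_set d E) (ev x)"
  let ?Z = "{(p :: int, q :: nat). 0 < q \<and> coprime p (int q) \<and> real_of_int p / real q \<in> ?S \<and>
        \<bar>y - real_of_int p / real q\<bar> \<le> (1/2) * \<psi> q / real q}"
  have "\<not> badly_intr_approx ?S \<psi> y" using y by (simp add: WA_int_def)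
  then have "\<not> (0 < (1/2 :: real) \<and> \<not> intr_approx ?S (\<lambda>q. (1/2) * \<psi> q) y)"
    unfolding badly_intr_approx_def by blast
  then have inf: "infinite ?Z" unfolding intr_approx_def by simp
  \<comment> \<open>Finitely many fractions have denominator \<open>d^n\<close> with
    \<open>n < m\<close>. The floor recovers the numerator when the centre is such a fraction and is
    harmless otherwise.\<close>
  let ?F = "(\<lambda>(n, w). (\<lfloor>centre x n w * real d ^ n\<rfloor>, d ^ n)) ` (SIGMA n:{..<m}. words n)"
  have "finite ?F" using finite_words by (intro finite_imageI finite_SigmaI) auto
  then have "\<not> ?Z \<subseteq> ?F" using inf finite_subset by blast
  then obtain p q where pq: "(p, q) \<in> ?Z" "(p, q) \<notin> ?F" by auto
  then have pq': "0 < q" "coprime p (int q)" "real_of_int p / real q \<in> ?S"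
    "\<bar>y - real_of_int p / real q\<bar> \<le> (1/2) * \<psi> q / real q" by auto
  obtain b where b: "b \<in> seqs" "ev b - ev x = real_of_int p / real q"
    using pq'(3) unfolding translate_set_def digit_set_eq by auto
  obtain n where n: "q = d ^ n"
    using denominator_is_power[OF d cE zero top x b(1) pq'(1,2) b(2)] by blast
  have "ev b - ev x = real_of_int p / real d ^ n" using b(2) n by simp
  then have "ev (tail n b) = ev (tail n x)" by (rule tails_agree[OF x(2,1) zero top b(1)])
  then have c: "centre x n (pre n b) = real_of_int p / real q"
    using b ev_eq[OF b(1), of n] by (simp add: centre_def add_divide_distrib)
  have "m \<le> n"
  proof (rule ccontr)
    assume "\<not> m \<le> n"
    moreover have "\<lfloor>centre x n (pre n b) * real d ^ n\<rfloor> = p" unfolding c using n d_pos by simp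
    ultimately have "(p, q) \<in> ?F" using n pre_words[OF b(1), of n]
      by (intro image_eqI[of _ _ "(n, pre n b)"]) auto
    then show False using pq(2) by simp
  qed
  moreover have "\<bar>y - centre x n (pre n b)\<bar> \<le> \<psi> (d ^ n) / real (d ^ n) / 2"
    using pq'(4) unfolding c n by simp
  ultimately show ?thesis using pre_words[OF b(1), of n] by blast
qed

lemma WA_int_null:
  assumes d: "prime d" and cE: "card E < d" and zero: "0 \<in> E" and top: "d - 1 \<in> E"
    and x: "x \<in> seqs" "generic x" and psi: "\<And>n. 0 < \<psi> n"
    and f: "mono_on {0<..} f" "\<And>t. 0 < t \<Longrightarrow> 0 < f t"
    and summ: "summable (\<lambda>n. f (\<psi> (d ^ Suc n) / real (d ^ Suc n)) * real N ^ Suc n)"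
  shows "hausdorff_measure f (WA_int (translate_set (digit_set d E) (ev x)) \<psi>) = 0"
  unfolding hausdorff_measure_eq_0_iff
proof (intro allI impI)
  fix r :: real assume r: "0 < r"
  let ?W = "WA_int (translate_set (digit_set d E) (ev x)) \<psi>"
  define X where "X n = \<psi> (d ^ n) / real (d ^ n)" for n
  define S where "S n = f (X (Suc n)) * real N ^ Suc n" for n
  have X: "0 < X n" for n unfolding X_def using psi d_ge by simp
  have S_nonneg: "0 \<le> S n" for n unfolding S_def using f(2)[OF X] N_pos by (simp add: less_imp_le)
  have summ: "summable S" using summ unfolding S_def X_def .
  \<comment> \<open>The covering intervals must become shorter than r. Convergence forces this,
    since \<open>X (Suc n) > r\<close> would give \<open>S n \<ge> f r\<close>.\<close>
  have "eventually (\<lambda>n. S n < f r) sequentially"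
    using summable_LIMSEQ_zero[OF summ] f(2)[OF r] by (rule order_tendstoD(2))
  then obtain m0 where m0: "\<And>n. m0 \<le> n \<Longrightarrow> S n < f r" unfolding eventually_sequentially by blast
  have Xr: "X (Suc n) \<le> r" if "m0 \<le> n" for n
  proof (rule ccontr)
    assume "\<not> X (Suc n) \<le> r"
    then have "f r \<le> f (X (Suc n))" using r X by (intro mono_onD[OF f(1)]) auto
    also have "\<dots> \<le> f (X (Suc n)) * real N ^ Suc n"
      using f(2)[OF X, of "Suc n"] N_gt1 by (simp add: mult_le_cancel_left1 one_le_power del: power_Suc)
    finally show False using m0[OF that] by (simp add: S_def)
  qed
  define I where "I n w = {centre x n w - X n / 2 .. centre x n w + X n / 2}" for n w
  have bound: "hausdorff_content f r ?W \<le> 0 + ennreal \<epsilon>" if eps: "0 < \<epsilon>" for \<epsilon>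
  proof -
    obtain m1 where m1: "\<And>n. m1 \<le> n \<Longrightarrow> norm (\<Sum>i. S (i + n)) < \<epsilon>"
      using suminf_exist_split[OF eps summ] by blast
    define m where "m = max m0 m1"
    have "?W \<subseteq> (\<Union>k. \<Union>w\<in>words (Suc (k + m)). I (Suc (k + m)) w)"
    proof
      fix y assume "y \<in> ?W"
      then obtain n w where n: "Suc m \<le> n" "w \<in> words n" "\<bar>y - centre x n w\<bar> \<le> X n / 2"
        using WA_int_cover[OF d cE zero top x, of y \<psi> "Suc m"] unfolding X_def by blast
      have "y \<in> I n w" unfolding I_def atLeastAtMost_iff using n(3) by linarith
      moreover have "n = Suc ((n - Suc m) + m)" using n(1) by simp
      ultimately have "y \<in> (\<Union>w\<in>words (Suc ((n - Suc m) + m)). I (Suc ((n - Suc m) + m)) w)"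
        using n(2) by (metis UN_I)
      then show "y \<in> (\<Union>k. \<Union>w\<in>words (Suc (k + m)). I (Suc (k + m)) w)" by (rule UN_I[OF UNIV_I])
    qed
    then have "hausdorff_content f r ?W \<le> hausdorff_content f r (\<Union>k. \<Union>w\<in>words (Suc (k + m)). I (Suc (k + m)) w)"
      by (rule hausdorff_content_mono)
    also have "\<dots> \<le> (\<Sum>k. hausdorff_content f r (\<Union>w\<in>words (Suc (k + m)). I (Suc (k + m)) w))"
      by (rule hausdorff_content_UN)
    also have "\<dots> \<le> (\<Sum>k. ennreal (S (k + m)))"
    proof (rule suminf_le)
      fix k
      let ?n = "Suc (k + m)"
      have "hausdorff_content f r (\<Union>w\<in>words ?n. I ?n w) \<le> (\<Sum>w\<in>words ?n. hausdorff_content f r (I ?n w))"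
        by (rule hausdorff_content_UN_finite) (use r finite_words in auto)
      also have "\<dots> \<le> (\<Sum>w\<in>words ?n. ennreal (f (X ?n)))"
      proof (rule sum_mono)
        fix w
        have dI: "diameter (I ?n w) = X ?n" using X[of ?n] by (simp add: I_def diameter_closed_interval)
        have "hausdorff_content f r (I ?n w) \<le> gauge_val f (diameter (I ?n w))"
        proof (rule hausdorff_content_le[OF order_refl])
          show "bounded (I ?n w)" by (simp add: I_def)
          show "diameter (I ?n w) \<le> r" unfolding dI by (rule Xr) (simp add: m_def)
        qed (use r in simp)
        also have "\<dots> = ennreal (f (X ?n))" unfolding dI gauge_val_def using X[of ?n] by simp
        finally show "hausdorff_content f r (I ?n w) \<le> ennreal (f (X ?n))" .
      qed
      also have "\<dots> = ennreal (real (N ^ ?n)) * ennreal (f (X ?n))"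
        by (simp only: sum_constant card_words ennreal_of_nat_eq_real_of_nat)
      also have "\<dots> = ennreal (S (k + m))"
        unfolding S_def using f(2)[OF X, of ?n] by (subst ennreal_mult[symmetric]) (simp_all add: mult.commute)
      finally show "hausdorff_content f r (\<Union>w\<in>words ?n. I ?n w) \<le> ennreal (S (k + m))" .
    qed auto
    also have "\<dots> = ennreal (\<Sum>k. S (k + m))"
      by (rule suminf_ennreal2) (simp_all add: S_nonneg summ)
    also have "\<dots> \<le> ennreal \<epsilon>" using m1[of m] by (intro ennreal_leI) (simp add: m_def)
    finally show ?thesis by simp
  qed
  have "hausdorff_content f r ?W \<le> 0" by (rule ennreal_le_epsilon) (rule bound)
  then show "hausdorff_content f r ?W = 0" by simp
qed

text \<open>The shortest run giving accuracy \<open>\<psi> / (j+1)\<close>. Minimality bounds \<psi>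
  from above up to a constant factor, except at length 0, which carries no such information.\<close>

definition match_length :: "(nat \<Rightarrow> real) \<Rightarrow> nat \<Rightarrow> nat \<Rightarrow> nat" where
  "match_length \<psi> j n = (LEAST k. 1 / real d ^ k \<le> \<psi> (d ^ Suc n) / real (Suc j))"

lemma match_length_le:
  assumes "\<And>n. 0 < \<psi> n"
  shows "1 / real d ^ match_length \<psi> j n \<le> \<psi> (d ^ Suc n) / real (Suc j)"
proof -
  have "0 < \<psi> (d ^ Suc n) / real (Suc j)" using assms by simp
  then have "\<exists>k. 1 / real d ^ k \<le> \<psi> (d ^ Suc n) / real (Suc j)" using inverse_power_small less_imp_le by blast
  then show ?thesis unfolding match_length_def by (rule LeastI_ex)
qed

lemma match_length_gt:
  assumes "match_length \<psi> j n \<noteq> 0"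
  shows "\<psi> (d ^ Suc n) / real (d ^ Suc n) \<le> (real (Suc j) * real d) * (1 / real d ^ (Suc n + match_length \<psi> j n))"
proof -
  obtain k where k: "match_length \<psi> j n = Suc k" using assms by (cases "match_length \<psi> j n") auto
  have "\<not> 1 / real d ^ k \<le> \<psi> (d ^ Suc n) / real (Suc j)"
  proof (rule not_less_Least[where P = "\<lambda>k. 1 / real d ^ k \<le> \<psi> (d ^ Suc n) / real (Suc j)"])
    show "k < (LEAST k. 1 / real d ^ k \<le> \<psi> (d ^ Suc n) / real (Suc j))"
      using k unfolding match_length_def by simp
  qed
  then have "\<psi> (d ^ Suc n) \<le> real (Suc j) * (1 / real d ^ k)" 
    using pos_divide_less_eq[of "real (Suc j)" "\<psi> (d ^ Suc n)" "1 / real d ^ k"] by (simp only: not_le mult.commute)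
  then have "\<psi> (d ^ Suc n) / real (d ^ Suc n) \<le> real (Suc j) * (1 / real d ^ k) / real (d ^ Suc n)"
    by (rule divide_right_mono) simp
  also have "\<dots> = (real (Suc j) * real d) * (1 / real d ^ (Suc n + match_length \<psi> j n))"
    unfolding k using d_pos by (simp add: power_add)
  finally show ?thesis .
qed


text \<open>By \<open>dom\<close> and \<open>match_length_gt\<close>, divergence of the given series
  passes to the probabilities \<open>1 / N^(\<kappa> + 1)\<close>. Hence the points that miss some
  accuracy from some place on form a countable union of null sets, and the two measures agree
  without being computed.\<close>

lemma WA_int_full:
  assumes d: "prime d" and x: "x \<in> seqs" and psi: "\<And>n. 0 < \<psi> n"
    and f: "\<And>t. 0 < t \<Longrightarrow> 0 < f t"
    and dom: "\<And>T. 0 < T \<Longrightarrow> \<exists>C\<ge>0. \<forall>t. 0 < t \<longrightarrow> t \<le> T \<longrightarrow> f t \<le> C * t powr delta"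
    and div: "\<not> summable (\<lambda>n. f (\<psi> (d ^ Suc n) / real (d ^ Suc n)) * real N ^ Suc n)"
  shows "hausdorff_measure f (WA_int (translate_set (digit_set d E) (ev x)) \<psi>) = hausdorff_measure f (digit_set d E)"
proof -
  let ?S = "translate_set (digit_set d E) (ev x)"
  let ?W = "WA_int ?S \<psi>"
  let ?\<kappa> = "match_length \<psi>"
  have "\<forall>n. \<exists>c. c \<in> E \<and> c \<noteq> x n" using exists_other by blast
  from choice[OF this] obtain e where e: "\<And>n. e n \<in> E" "\<And>n. e n \<noteq> x n" by blast
  have div': "\<not> summable (\<lambda>n. 1 / real N ^ Suc (?\<kappa> j n))" for j
  proof
    assume summ: "summable (\<lambda>n. 1 / real N ^ Suc (?\<kappa> j n))"
    define T where "T = real (Suc j) * real d"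
    have T: "0 < T" using d_pos by (simp add: T_def)
    obtain C where C: "0 \<le> C" "\<And>t. 0 < t \<Longrightarrow> t \<le> T \<Longrightarrow> f t \<le> C * t powr delta" using dom[OF T] by blast
    \<comment> \<open>A term below \<open>1 / N\<close> excludes run length 0.\<close>
    have "eventually (\<lambda>n. 1 / real N ^ Suc (?\<kappa> j n) < 1 / real N) sequentially"
      by (rule order_tendstoD(2)[OF summable_LIMSEQ_zero[OF summ]]) (use N_pos in simp)
    then have "eventually (\<lambda>n. norm (f (\<psi> (d ^ Suc n) / real (d ^ Suc n)) * real N ^ Suc n)
      \<le> (C * T powr delta * real N) * (1 / real N ^ Suc (?\<kappa> j n))) sequentially"
    proof eventually_elim
      case (elim n)
      define X where "X = \<psi> (d ^ Suc n) / real (d ^ Suc n)"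
      have X: "0 < X" using psi d_ge by (simp add: X_def)
      define m where "m = Suc n + ?\<kappa> j n"
      have "?\<kappa> j n \<noteq> 0"
      proof
        assume "?\<kappa> j n = 0"
        then show False using elim by simp
      qed
      then have XT: "X \<le> T * (1 / real d ^ m)" unfolding X_def T_def m_def by (rule match_length_gt)
      also have "\<dots> \<le> T * 1" using T d_gt1 by (intro mult_left_mono) auto
      finally have "f X \<le> C * X powr delta" using C(2)[OF X] by simp
      also have "\<dots> \<le> C * (T * (1 / real d ^ m)) powr delta"
        using C(1) X XT delta_pos by (intro mult_left_mono powr_mono2) auto
      also have "(T * (1 / real d ^ m)) powr delta = T powr delta * (1 / real N ^ m)"
        using T d_pos by (subst powr_mult) (simp_all only: inverse_powr_delta)
      finally have "f X * real N ^ Suc n \<le> (C * (T powr delta * (1 / real N ^ m))) * real N ^ Suc n"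
        by (rule mult_right_mono) simp
      also have "\<dots> = (C * T powr delta * real N) * (1 / real N ^ Suc (?\<kappa> j n))"
        using N_pos by (simp add: m_def power_add)
      finally show ?case using f[OF X] by (simp only: X_def[symmetric]) (simp add: abs_mult)
    qed
    then have "summable (\<lambda>n. f (\<psi> (d ^ Suc n) / real (d ^ Suc n)) * real N ^ Suc n)"
      by (rule summable_comparison_test_ev) (rule summable_mult[OF summ])
    then show False using div by contradiction
  qed
  define B where "B = (\<lambda>(j, m). ev ` {a \<in> seqs. \<forall>n. \<not> occ a (n + m) (target e x (?\<kappa> j) (n + m))})"
  obtain C where C: "0 \<le> C" "\<And>t. 0 < t \<Longrightarrow> t \<le> 1 \<Longrightarrow> f t \<le> C * t powr delta"
    using dom[of 1] by auto
  have "hausdorff_measure f (B i) = 0" for i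
  proof -
    obtain j m where i: "i = (j, m)" by (cases i)
    show ?thesis unfolding i B_def prod.case
    proof (rule hausdorff_null_avoid_blocks[OF _ _ _ C(2,1)])
      show "set (target e x (?\<kappa> j) (n + m)) \<subseteq> E" for n
        by (rule set_target[of x e "n + m", OF x e(1)])
      show "\<not> summable (\<lambda>n. 1 / real N ^ length (target e x (?\<kappa> j) (n + m)))"
        using div'[of j] summable_iff_shift[of "\<lambda>n. 1 / real N ^ Suc (?\<kappa> j n)" m] by simp
      fix n n' :: nat assume nn: "n < n'"
      show "n + m + length (target e x (?\<kappa> j) (n + m)) \<le> n' + m \<or>
        (\<forall>a. \<not> (occ a (n + m) (target e x (?\<kappa> j) (n + m)) \<and> occ a (n' + m) (target e x (?\<kappa> j) (n' + m))))"
      proof (rule disjCI)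
        assume "\<not> (\<forall>a. \<not> (occ a (n + m) (target e x (?\<kappa> j) (n + m)) \<and> occ a (n' + m) (target e x (?\<kappa> j) (n' + m))))"
        then obtain a where a: "occ a (n + m) (target e x (?\<kappa> j) (n + m))" "occ a (n' + m) (target e x (?\<kappa> j) (n' + m))"
          by blast
        show "n + m + length (target e x (?\<kappa> j) (n + m)) \<le> n' + m"
        proof (rule ccontr)
          assume "\<not> ?thesis"
          \<comment> \<open>Overlapping blocks contradict each other: the run of the earlier one
            prescribes \<open>x\<close> at the place where the later one has its mismatch
            letter.\<close>
          then have i: "n' - n < Suc (?\<kappa> j (n + m))" using nn by simp
          have "a (n + m + (n' - n)) = target e x (?\<kappa> j) (n + m) ! (n' - n)"
            using a(1) i unfolding occ_def length_target by blast
          also have "\<dots> = x (n + m + (n' - n))"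
            using nn nth_target[of "n' - n" "?\<kappa> j" "n + m" e x, OF i] by simp
          finally have "a (n + m + (n' - n)) = x (n + m + (n' - n))" .
          moreover have "a (n' + m + 0) = e (n' + m)"
            using a(2) nth_target[of 0 "?\<kappa> j" "n' + m" e x] unfolding occ_def by (auto dest!: spec[of _ 0])
          moreover have "n + m + (n' - n) = n' + m" using nn by simp
          ultimately show False using e(2)[of "n' + m"] by simp
        qed
      qed
    qed
  qed
  then have null: "hausdorff_measure f (\<Union>i. B i) = 0" by (intro hausdorff_measure_0_UN_countable) auto
  have "?S \<subseteq> ?W \<union> (\<lambda>t. t - ev x) ` (\<Union>i. B i)"
  proof
    fix y assume "y \<in> ?S"
    then obtain a where a: "a \<in> seqs" "y = ev a - ev x" unfolding translate_set_def digit_set_eq by auto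
    show "y \<in> ?W \<union> (\<lambda>t. t - ev x) ` (\<Union>i. B i)"
    proof (cases "\<forall>j m. \<exists>n\<ge>m. occ a n (target e x (?\<kappa> j) n)")
      case True
      then have "\<And>j m. \<exists>n\<ge>m. \<exists>j'\<ge>j. occ a n (target e x (?\<kappa> j') n)" by blast
      then have "y \<in> ?W" unfolding a(2)
        by (rule WA_int_memI[OF d x a(1) e(2) psi match_length_le[OF psi]])
      then show ?thesis by simp
    next
      case False
      then obtain j m where jm: "\<And>n. m \<le> n \<Longrightarrow> \<not> occ a n (target e x (?\<kappa> j) n)" by blast
      then have "ev a \<in> B (j, m)" unfolding B_def using a(1) by simp
      then have "ev a \<in> (\<Union>i. B i)" by (rule UN_I[OF UNIV_I])
      then show ?thesis using a(2) by blast
    qed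
  qed
  moreover have "?W \<subseteq> ?S" unfolding WA_int_def by auto
  moreover have "hausdorff_measure f (?W \<union> (\<lambda>t. t - ev x) ` (\<Union>i. B i)) = hausdorff_measure f ?W"
    by (rule hausdorff_measure_Un_null) (simp only: hausdorff_measure_translate null)
  ultimately have "hausdorff_measure f ?S = hausdorff_measure f ?W"
    using hausdorff_measure_mono[of ?S "?W \<union> (\<lambda>t. t - ev x) ` (\<Union>i. B i)" f] hausdorff_measure_mono[of ?W ?S f]
    by (intro antisym) simp_all
  then show ?thesis by (simp add: translate_set_def hausdorff_measure_translate)
qed

lemma WA_int_top:
  assumes d: "prime d" and x: "x \<in> seqs" and psi: "\<And>n. 0 < \<psi> n"
    and f: "mono_on {0<..} f" "\<And>t. 0 < t \<Longrightarrow> 0 < f t" "(f \<longlongrightarrow> 0) (at_right 0)"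
    and anti: "monotone_on {0<..} (\<le>) (\<ge>) (\<lambda>t. t powr (- delta) * f t)"
    and unbounded: "\<And>c. \<exists>k. c \<le> real N ^ k * f (1 / real d ^ k)"
    and div: "\<not> summable (\<lambda>n. f (\<psi> (d ^ Suc n) / real (d ^ Suc n)) * real N ^ Suc n)"
  shows "hausdorff_measure f (WA_int (translate_set (digit_set d E) (ev x)) \<psi>) = top"
    and "hausdorff_measure f (digit_set d E) = top"
proof -
  let ?W = "WA_int (translate_set (digit_set d E) (ev x)) \<psi>"
  let ?\<kappa> = "match_length \<psi>"
  have "\<forall>n. \<exists>c. c \<in> E \<and> c \<noteq> x n" using exists_other by blast
  from choice[OF this] obtain e where e: "\<And>n. e n \<in> E" "\<And>n. e n \<noteq> x n" by blast
  have antiD: "t powr (- delta) * f t \<le> s powr (- delta) * f s" if "0 < s" "s \<le> t" for s t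
    using monotone_onD[OF anti, of s t] that by simp
  have phi_eq: "real N ^ k * f (1 / real d ^ k) = (1 / real d ^ k) powr (- delta) * f (1 / real d ^ k)" for k
    by (simp only: powr_minus inverse_powr_delta) simp
  have phi: "real N ^ k * f (1 / real d ^ k) \<le> real N ^ l * f (1 / real d ^ l)" if "k \<le> l" for k l
    unfolding phi_eq
    by (rule antiD) (use that d_gt1 in \<open>simp_all add: divide_simps power_increasing\<close>)
  have div': "\<not> summable (\<lambda>n. real N ^ n * f (1 / real d ^ (Suc n + ?\<kappa> j n)))" for j
  proof
    assume summ: "summable (\<lambda>n. real N ^ n * f (1 / real d ^ (Suc n + ?\<kappa> j n)))"
    define T where "T = real (Suc j) * real d"
    have "1 * 1 \<le> real (Suc j) * real d" using d_gt1 by (intro mult_mono) auto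
    then have T: "1 \<le> T" by (simp add: T_def)
    have "eventually (\<lambda>n. real N ^ n * f (1 / real d ^ (Suc n + ?\<kappa> j n)) < f 1 / real N) sequentially"
      by (rule order_tendstoD(2)[OF summable_LIMSEQ_zero[OF summ]]) (use N_pos f(2) in simp)
    then have "eventually (\<lambda>n. norm (f (\<psi> (d ^ Suc n) / real (d ^ Suc n)) * real N ^ Suc n)
      \<le> (T powr delta * real N) * (real N ^ n * f (1 / real d ^ (Suc n + ?\<kappa> j n)))) sequentially"
    proof eventually_elim
      case (elim n)
      define X where "X = \<psi> (d ^ Suc n) / real (d ^ Suc n)"
      have X: "0 < X" using psi d_ge by (simp add: X_def)
      define t where "t = 1 / real d ^ (Suc n + ?\<kappa> j n)"
      have t: "0 < t" unfolding t_def using d_pos by simp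
      \<comment> \<open>Run length 0 would make the term at least \<open>f 1 / N\<close>, because
        \<open>N^k * f (1 / d^k)\<close> increases from its value \<open>f 1\<close> at
        \<open>k = 0\<close>.\<close>
      have "?\<kappa> j n \<noteq> 0"
      proof
        assume 0: "?\<kappa> j n = 0"
        have "f 1 \<le> real N ^ Suc n * f (1 / real d ^ Suc n)" using phi[of 0 "Suc n"] by simp
        then have "f 1 / real N \<le> real N ^ n * f (1 / real d ^ Suc n)"
          using N_pos by (simp add: pos_divide_le_eq mult_ac)
        then show False using elim unfolding 0 by simp
      qed
      then have XT: "X \<le> T * t" unfolding X_def T_def t_def by (rule match_length_gt)
      have tT: "t \<le> T * t" using T t by simp
      have "f X \<le> f (T * t)" using XT X tT t T by (intro mono_onD[OF f(1)]) auto
      \<comment> \<open>The doubling property of f that comes with the decreasing ratio.\<close>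
      also have "\<dots> \<le> T powr delta * f t"
      proof -
        have "(T * t) powr (- delta) * f (T * t) \<le> t powr (- delta) * f t" by (rule antiD[OF t tT])
        then have "t powr (- delta) * (T powr (- delta) * f (T * t)) \<le> t powr (- delta) * f t"
          using T t by (simp add: powr_mult mult_ac)
        then have "T powr (- delta) * f (T * t) \<le> f t" using t by simp
        then show ?thesis using T by (simp add: powr_minus field_simps)
      qed
      finally have "f X * real N ^ Suc n \<le> (T powr delta * f t) * real N ^ Suc n"
        by (rule mult_right_mono) simp
      also have "\<dots> = (T powr delta * real N) * (real N ^ n * f t)" by simp
      finally show ?case using f(2)[OF X] by (simp only: X_def[symmetric] t_def[symmetric]) (simp add: abs_mult)
    qed
    then have "summable (\<lambda>n. f (\<psi> (d ^ Suc n) / real (d ^ Suc n)) * real N ^ Suc n)"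
      by (rule summable_comparison_test_ev) (rule summable_mult[OF summ])
    then show False using div by contradiction
  qed
  let ?T = "{a \<in> seqs. \<forall>j. \<exists>n\<ge>j. occ a n (target e x (?\<kappa> j) n)}"
  have top: "hausdorff_measure f (ev ` ?T) = top"
    by (rule hausdorff_limsup_infinite[OF x e f phi unbounded div'])
  have "(\<lambda>t. t - ev x) ` ev ` ?T \<subseteq> ?W"
  proof
    fix y assume "y \<in> (\<lambda>t. t - ev x) ` ev ` ?T"
    then obtain a where a: "a \<in> seqs" "\<And>j. \<exists>n\<ge>j. occ a n (target e x (?\<kappa> j) n)" "y = ev a - ev x" by blast
    have "\<exists>n\<ge>m. \<exists>j'\<ge>j. occ a n (target e x (?\<kappa> j') n)" for j m
    proof -
      \<comment> \<open>In the limsup set the index also bounds the place from below, so the maximum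
        serves both demands.\<close>
      obtain n where "max j m \<le> n" "occ a n (target e x (?\<kappa> (max j m)) n)" using a(2) by blast
      then show ?thesis by (meson max.cobounded1 max.cobounded2 order_trans)
    qed
    then show "y \<in> ?W" unfolding a(3)
      by (rule WA_int_memI[OF d x a(1) e(2) psi match_length_le[OF psi]])
  qed
  from hausdorff_measure_mono[OF this, of f] show "hausdorff_measure f ?W = top"
    unfolding hausdorff_measure_translate top by (simp only: top_unique)
  have "ev ` ?T \<subseteq> digit_set d E" unfolding digit_set_eq by (rule image_mono) simp
  from hausdorff_measure_mono[OF this, of f] show "hausdorff_measure f (digit_set d E) = top"
    unfolding top by (simp only: top_unique)
qed

lemma WA_int_dichotomy:
  assumes d: "prime d" and cE: "card E < d" and zero: "0 \<in> E" and top: "d - 1 \<in> E"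
    and x: "x \<in> seqs" "generic x" and psi: "\<And>n. 0 < \<psi> n" and f: "dimension_function f"
    and mono: "mono_on {0<..} (\<lambda>t. t powr (- delta) * f t) \<or> monotone_on {0<..} (\<le>) (\<ge>) (\<lambda>t. t powr (- delta) * f t)"
  defines "S \<equiv> \<lambda>n. f (\<psi> (d ^ Suc n) / real (d ^ Suc n)) * real N ^ Suc n"
    and "W \<equiv> WA_int (translate_set (digit_set d E) (ev x)) \<psi>"
  shows "summable S \<Longrightarrow> hausdorff_measure f W = 0"
    and "\<not> summable S \<Longrightarrow> hausdorff_measure f W = hausdorff_measure f (digit_set d E)"
proof -
  have f: "mono_on {0<..} f" "\<And>t. 0 < t \<Longrightarrow> 0 < f t" "(f \<longlongrightarrow> 0) (at_right 0)"
    using f unfolding dimension_function_def by auto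
  show "hausdorff_measure f W = 0" if "summable S"
    unfolding W_def by (rule WA_int_null[OF d cE zero top x psi f(1,2) that[unfolded S_def]])
  show "hausdorff_measure f W = hausdorff_measure f (digit_set d E)" if div: "\<not> summable S"
  proof -
    note div = div[unfolded S_def]
    have ratio: "f t = (t powr (- delta) * f t) * t powr delta" if "0 < t" for t
      using that by (simp add: powr_minus)
    show ?thesis
    proof (cases "\<exists>c. \<forall>k. real N ^ k * f (1 / real d ^ k) < c")
      case bounded: True
      then obtain c where c: "\<And>k. real N ^ k * f (1 / real d ^ k) < c" by blast
      \<comment> \<open>An increasing ratio is bounded on (0,T] by its value at T. A decreasing one
        is bounded by its values at the points \<open>1 / d^k\<close>, that is, by c.\<close>
      have dom: "\<exists>C\<ge>0. \<forall>t. 0 < t \<longrightarrow> t \<le> T \<longrightarrow> f t \<le> C * t powr delta" if T: "0 < T" for T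
        using mono
      proof
        assume m: "mono_on {0<..} (\<lambda>t. t powr (- delta) * f t)"
        have "f t \<le> (T powr (- delta) * f T) * t powr delta" if t: "0 < t" "t \<le> T" for t
        proof -
          have "t powr (- delta) * f t \<le> T powr (- delta) * f T" using mono_onD[OF m, of t T] t by simp
          then show ?thesis by (subst ratio[OF t(1)]) (rule mult_right_mono, simp_all)
        qed
        moreover have "0 \<le> T powr (- delta) * f T" using f(2)[OF T] by simp
        ultimately show ?thesis by blast
      next
        assume a: "monotone_on {0<..} (\<le>) (\<ge>) (\<lambda>t. t powr (- delta) * f t)"
        have "f t \<le> c * t powr delta" if t: "0 < t" for t
        proof -
          obtain k where k: "1 / real d ^ k < t" using inverse_power_small[OF t] by blast
          have "t powr (- delta) * f t \<le> (1 / real d ^ k) powr (- delta) * f (1 / real d ^ k)"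
            using monotone_onD[OF a, of "1 / real d ^ k" t] k t d_pos by simp
          also have "(1 / real d ^ k) powr (- delta) = real N ^ k"
            by (simp only: powr_minus inverse_powr_delta) simp
          also have "real N ^ k * f (1 / real d ^ k) \<le> c" using c less_imp_le by blast
          finally show ?thesis by (subst ratio[OF t(1)]) (rule mult_right_mono, simp_all)
        qed
        moreover have "0 \<le> c" using c[of 0] f(2)[of 1] by simp
        ultimately show ?thesis by blast
      qed
      show ?thesis unfolding W_def by (rule WA_int_full[OF d x(1) psi f(2) dom div])
    next
      case unbounded: False
      then have unb: "\<And>c. \<exists>k. c \<le> real N ^ k * f (1 / real d ^ k)" by (meson not_less)
      \<comment> \<open>An increasing ratio would be bounded by \<open>f 1\<close> on (0,1], so an
        unbounded one decreases.\<close>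
      have anti: "monotone_on {0<..} (\<le>) (\<ge>) (\<lambda>t. t powr (- delta) * f t)"
      proof (rule ccontr)
        assume "\<not> ?thesis"
        then have m: "mono_on {0<..} (\<lambda>t. t powr (- delta) * f t)" using mono by simp
        have "real N ^ k * f (1 / real d ^ k) < f 1 + 1" for k
        proof -
          have "(1 / real d ^ k) powr (- delta) * f (1 / real d ^ k) \<le> 1 powr (- delta) * f 1"
            using mono_onD[OF m, of "1 / real d ^ k" 1] d_gt1 by simp
          moreover have "(1 / real d ^ k) powr (- delta) = real N ^ k"
            by (simp only: powr_minus inverse_powr_delta) simp
          ultimately show ?thesis by simp
        qed
        then show False using unbounded by blast
      qed
      show ?thesis unfolding W_def using WA_int_top[OF d x(1) psi f anti unb div] by simp
    qed
  qed
qed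

end

theorem theorem3p8:
  fixes d :: nat and E :: "nat set"
  assumes "prime d"
    and "E \<subseteq> {0..<d}" and "1 < card E" and "card E < d"
    and "0 \<in> E" and "d - 1 \<in> E" and "\<forall>a\<in>E. a + 1 \<notin> E"
  shows "AE x in normalized_hausdorff (hausdorff_dim (digit_set d E)) (digit_set d E).
    x \<in> digit_set d E \<longrightarrow>
    (\<forall>(\<psi> :: nat \<Rightarrow> real) (f :: real \<Rightarrow> real).
       (\<forall>n. 0 < \<psi> n) \<and> dimension_function f \<and>
       (mono_on {0<..} (\<lambda>t. t powr (- hausdorff_dim (digit_set d E)) * f t) \<or>
        monotone_on {0<..} (\<le>) (\<ge>) (\<lambda>t. t powr (- hausdorff_dim (digit_set d E)) * f t))
     \<longrightarrow>
       (let S = (\<lambda>n. f (\<psi> (d ^ Suc n) / real (d ^ Suc n)) *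
                    real (d ^ Suc n) powr hausdorff_dim (digit_set d E));
            W = WA_int (translate_set (digit_set d E) x) \<psi>
        in (summable S \<longrightarrow> hausdorff_measure f W = 0) \<and>
           (\<not> summable S \<longrightarrow> hausdorff_measure f W = hausdorff_measure f (digit_set d E))))"
proof -
  interpret digit_system d E
    using assms prime_ge_2_nat by unfold_locales auto
  have pw: "real (d ^ Suc n) powr delta = real N ^ Suc n" for n
    using powr_delta[of "Suc n"] by (simp only: of_nat_power)
  show ?thesis
    unfolding hausdorff_dim_digit_set pw
  \<comment> \<open>The exceptional set consists of the nongeneric points and depends on neither
    \<psi> nor f, so one null set serves them all.\<close>
  proof (rule AE_normalized_hausdorff[OF hausdorff_null_nongeneric], intro impI allI)
    fix y :: real and \<psi> :: "nat \<Rightarrow> real" and f :: "real \<Rightarrow> real"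
    assume y: "y \<notin> ev ` {a \<in> seqs. \<not> generic a}" "y \<in> digit_set d E"
      and h: "(\<forall>n. 0 < \<psi> n) \<and> dimension_function f \<and>
       (mono_on {0<..} (\<lambda>t. t powr (- delta) * f t) \<or> monotone_on {0<..} (\<le>) (\<ge>) (\<lambda>t. t powr (- delta) * f t))"
    obtain x where x: "x \<in> seqs" "y = ev x" using y(2) unfolding digit_set_eq by blast
    have g: "generic x" using y(1) x by blast
    show "let S = (\<lambda>n. f (\<psi> (d ^ Suc n) / real (d ^ Suc n)) * real N ^ Suc n);
            W = WA_int (translate_set (digit_set d E) y) \<psi>
        in (summable S \<longrightarrow> hausdorff_measure f W = 0) \<and>
           (\<not> summable S \<longrightarrow> hausdorff_measure f W = hausdorff_measure f (digit_set d E))"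
      using WA_int_dichotomy[OF assms(1,4,5,6) x(1) g, of \<psi> f] h unfolding x(2) Let_def by blast
  qed
qed

end
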